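(* Let $\mathfrak{g}\subseteq\Xi$ be a finite-dimensional Lie algebra of vector fields on a manifold $\mathcal{M}$, with generators (basis) $\{t_i\}$, $[t_i,t_j]=f_{ij}^{\ \ k}t_k$, and let $(\Xi_\star,[\cdot,\cdot]_\star)$ be the $\star$-Lie algebra of vector fields deformed by a Reshetikhin-Jambor-Sykora twist $\mathcal{F}_V=\exp\bigl(-\tfrac{i\lambda}{2}\theta^{ab}V_a\otimes V_b\bigr)$, constructed with an arbitrary set of mutually commuting vector fields $V_a\in\Xi$. For a symmetry reduction respecting the following minimal axioms (a), (b), that is, for there to exist deformed generators $t_i^\star=t_i+\sum_{n\ge1}\lambda^n t_i^{(n)}$, $t_i^{(n)}\in\Xi_\star$, whose span $\mathfrak{g}_\star=\mathrm{span}(t_i^\star)$ satisfies (a) $[\mathfrak{g}_\star,\mathfrak{g}_\star]_\star\subseteq\mathfrak{g}_\star$, i.e. $[t_i^\star,t_j^\star]_\star=f_{ij}^{\star\,k}t_k^\star$ with $f_{ij}^{\star\,k}=f_{ij}^{\ \ k}+\mathcal{O}(\lambda)$, (b) $\Delta_\star(\mathfrak{g}_\star)\subseteq\mathfrak{g}_\star\otimes1+U\Xi_\star\otimes\mathfrak{g}_\star$, which is equivalent to $\bar R_\alpha(\mathfrak{g}_\star)\subseteq\mathfrak{g}_\star$ for all $\alpha$, it is necessary that $[V_a,\mathfrak{g}]\subseteq\mathfrak{g}$ for all $a$. In other words, $\mathrm{span}(t_i,V_a)$ with the undeformed Lie bracket forms a Lie algebra (contained in $\Xi$) with ideal $\m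athfrak{g}$.
   Context: $\Xi$ is the Lie algebra of smooth vector fields on $\mathcal{M}$, $U\Xi$ its universal enveloping algebra with the usual Hopf structure ($\Delta(u)=u\otimes1+1\otimes u$, $\epsilon(u)=0$, $S(u)=-u$ for $u\in\Xi$). Everything is understood as formal power series in the deformation parameter $\lambda$. Repeated indices are summed. $U\Xi$ acts on $U\Xi$ by extending the Lie derivative to the adjoint action; $\xi(u)$ denotes this action, so for $V,u\in\Xi$, $V(u)=[V,u]$. The matrix $\theta$ is constant and antisymmetric; without loss of generality the number of vector fields $V_1,V_2,\dots$ is even and $\theta$ has maximal rank and is block diagonal with blocks $\begin{pmatrix}0&1\\-1&0\end{pmatrix}$ (lower rank is obtained by choosing some of the $V_a$ to be zero). Notation: $\mathcal{F}=f^\alpha\otimes f_\alpha$, $\mathcal{F}^{-1}=\bar f^\alpha\otimes\bar f_\alpha$, $\mathcal{F}_{21}=f_\alpha\otimes f^\alpha$, $R=\mathcal{F}_{21}\mathcal{F}^{-1}$, $R^{-1}=\bar R^\alpha\otimes\bar R_\alpha$, $\chi=f^\alpha S(f_\alpha)$, and $X_\xi=\bar f^\alpha\,\xi\,\chi\,S^{-1}(\bar f_\alpha)$ for $\xi\in U\Xi$; the decompositions of $\mathcal{F}$, $\mathcal{F}^{-1}$, $R$, $R^{-1}$ are written, without loss of generality, with linearly independent summands (by combining linearly dependent ones). For the twist $\mathcal{F}_V$ one has $R^{-1}=\exp(-i\lambda\theta^{ab}V_a\otimes V_b)$. The $\star$-Lie algebra is $\Xi_\star=\Xi$ as a vector space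 with $[u,v]_\star=[\bar f^\alpha(u),\bar f_\alpha(v)]$. $U\Xi_\star=U\Xi$ as a vector space, with product $\xi\star\eta=\bar f^\alpha(\xi)\,\bar f_\alpha(\eta)$ and coproduct given on $u\in\Xi$ by $\Delta_\star(u)=u\otimes1+X_{\bar R^\alpha}\otimes\bar R_\alpha(u)$.
   Formalization: The nonzero V_a are assumed distinct and linearly independent, and in each 2x2 block of θ both V_a vanish or neither does; otherwise the claim fails (V_1=0, V_2 arbitrary gives a trivial twist with no condition on V_2). Every such twist can be written this way. *)

theory Defs
  imports "HOL-Analysis.Analysis" "HOL-Library.Poly_Mapping"
    "HOL-Computational_Algebra.Formal_Power_Series"
begin

text \<open>
  Points of \<open>\<real>\<^sup>n\<close> are the functions of type \<open>nat \<Rightarrow> real\<close> that vanish from \<open>n\<close> on, as in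
  \<^const>\<open>Euclidean_space\<close>.  On an open subset \<open>W\<close> of it, \<open>smooth_on n W f\<close> says that all iterated partial
  derivatives in the first \<open>n\<close> coordinates exist and are continuous.
\<close>

definition partial_derivative :: "nat \<Rightarrow> ((nat \<Rightarrow> real) \<Rightarrow> 'b) \<Rightarrow> (nat \<Rightarrow> real) \<Rightarrow> 'b::real_normed_vector"
  where "partial_derivative i f x = vector_derivative (\<lambda>s. f (x(i := s))) (at (x i))"

primrec Ck_on :: "nat \<Rightarrow> nat \<Rightarrow> (nat \<Rightarrow> real) set \<Rightarrow> ((nat \<Rightarrow> real) \<Rightarrow> 'b::real_normed_vector) \<Rightarrow> bool"
  where
    "Ck_on n 0 W f \<longleftrightarrow> continuous_on W f"
  | "Ck_on n (Suc k) W f \<longleftrightarrow> continuous_on W f \<and>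
       (\<forall>i<n. (\<forall>x\<in>W. (\<lambda>s. f (x(i := s))) differentiable at (x i)) \<and>
              Ck_on n k W (partial_derivative i f))"

definition smooth_on :: "nat \<Rightarrow> (nat \<Rightarrow> real) set \<Rightarrow> ((nat \<Rightarrow> real) \<Rightarrow> 'b::real_normed_vector) \<Rightarrow> bool"
  where "smooth_on n W f \<longleftrightarrow> (\<forall>k. Ck_on n k W f)"

text \<open>
  Each chart \<open>(U, \<phi>)\<close> is a homeomorphism of the open set \<open>U\<close> onto an open subset of \<open>\<real>\<^sup>n\<close>.  In the class
  assumptions \<open>topology open\<close> is \<^const>\<open>euclidean\<close> with its definition unfolded.
\<close>

class charted_space =
  fixes mdim :: "'a itself \<Rightarrow> nat"
    and atlas :: "('a set \<times> ('a \<Rightarrow> nat \<Rightarrow> real)) set"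

class smooth_manifold = charted_space + t2_space + second_countable_topology +
  assumes atlas_covers: "(\<Union>(U, \<phi>)\<in>atlas. U) = UNIV"
    and chart_domain_open: "(U, \<phi>) \<in> atlas \<Longrightarrow> open U"
    and chart_image_open: "(U, \<phi>) \<in> atlas \<Longrightarrow> openin (Euclidean_space (mdim TYPE('a))) (\<phi> ` U)"
    and chart_homeomorphism: "(U, \<phi>) \<in> atlas \<Longrightarrow>
         homeomorphic_map (subtopology (topology open) U)
           (subtopology (Euclidean_space (mdim TYPE('a))) (\<phi> ` U)) \<phi>"
    and chart_transition_smooth:
      "(U, \<phi>) \<in> atlas \<Longrightarrow> (U', \<phi>') \<in> atlas \<Longrightarrow> i < mdim TYPE('a) \<Longrightarrow>
         smooth_on (mdim TYPE('a)) (\<phi> ` (U \<inter> U')) (\<lambda>x. \<phi>' (inv_into U \<phi> x) i)"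

definition smooth_fun :: "('m::smooth_manifold \<Rightarrow> complex) \<Rightarrow> bool"
  where "smooth_fun f \<longleftrightarrow>
    (\<forall>(U, \<phi>)\<in>atlas. smooth_on (mdim TYPE('m)) (\<phi> ` U) (\<lambda>x. f (inv_into U \<phi> x)))"

lemma Euclidean_open_line:
  assumes W: "openin (Euclidean_space n) W" and x: "x \<in> W" and i: "i < n"
  obtains S where "open S" "x i \<in> S" "\<And>s. s \<in> S \<Longrightarrow> x(i := s) \<in> W"
proof -
  have xt: "x \<in> topspace (Euclidean_space n)"
    using openin_subset[OF W] x by auto
  have "continuous_map euclideanreal (Euclidean_space n) (\<lambda>s j. if j < n then (x(i := s)) j else 0)"
    unfolding continuous_map_componentwise_Euclidean_space by auto
  moreover have "(\<lambda>s j. if j < n then (x(i := s)) j else 0) = (\<lambda>s. x(i := s))"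
    using xt i by (auto simp: fun_eq_iff topspace_Euclidean_space)
  ultimately have "continuous_map euclideanreal (Euclidean_space n) (\<lambda>s. x(i := s))" by simp
  then have "openin euclideanreal {s \<in> topspace euclideanreal. x(i := s) \<in> W}"
    using W by (rule openin_continuous_map_preimage)
  then have "open {s. x(i := s) \<in> W}" by (simp add: open_openin[symmetric])
  then show thesis using x by (intro that[of "{s. x(i := s) \<in> W}"]) auto
qed

lemma Ck_on_cong:
  assumes W: "openin (Euclidean_space n) W" and eq: "\<And>x. x \<in> W \<Longrightarrow> f x = g x" and f: "Ck_on n k W f"
  shows "Ck_on n k W g"
  using eq f
proof (induction k arbitrary: f g)
  case 0
  then show ?case using continuous_on_eq by (auto intro: continuous_on_eq)
next
  case (Suc k)
  have d: "((\<lambda>s. g (x(i := s))) has_vector_derivative partial_derivative i f x) (at (x i))"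
    if "i < n" "x \<in> W" for i x
  proof -
    from Euclidean_open_line[OF W \<open>x \<in> W\<close> \<open>i < n\<close>] obtain S
      where S: "open S" "x i \<in> S" "\<And>s. s \<in> S \<Longrightarrow> x(i := s) \<in> W" by blast
    have "((\<lambda>s. f (x(i := s))) has_vector_derivative partial_derivative i f x) (at (x i))"
      using Suc.prems(2) that unfolding partial_derivative_def by (simp add: vector_derivative_works)
    then show ?thesis
      by (rule has_vector_derivative_transform_within_open[OF _ S(1,2)]) (use S(3) Suc.prems(1) in auto)
  qed
  have "continuous_on W g" using Suc.prems by (auto intro: continuous_on_eq)
  moreover have "Ck_on n k W (partial_derivative i g)" if "i < n" for i
  proof (rule Suc.IH)
    show "partial_derivative i f x = partial_derivative i g x" if "x \<in> W" for x
      using vector_derivative_at[OF d[OF \<open>i < n\<close> that]] by (simp add: partial_derivative_def)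
    show "Ck_on n k W (partial_derivative i f)" using Suc.prems(2) that by simp
  qed
  ultimately show ?case using d by (auto intro: differentiableI_vector)
qed

lemma Ck_on_mono: "Ck_on n (Suc k) W f \<Longrightarrow> Ck_on n k W f"
  by (induction k arbitrary: f) auto

lemma Ck_on_const: "Ck_on n k W (\<lambda>x. c)"
proof (induction k arbitrary: c)
  case (Suc k)
  have "partial_derivative i (\<lambda>x. c) = (\<lambda>x. 0)" for i :: nat
    by (auto simp: partial_derivative_def fun_eq_iff)
  then show ?case using Suc by simp
qed simp

lemma Ck_on_add:
  assumes W: "openin (Euclidean_space n) W" and "Ck_on n k W f" "Ck_on n k W g"
  shows "Ck_on n k W (\<lambda>x. f x + g x)"
  using assms(2,3)
proof (induction k arbitrary: f g)
  case (Suc k)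
  have d: "partial_derivative i f x + partial_derivative i g x = partial_derivative i (\<lambda>x. f x + g x) x"
    if "i < n" "x \<in> W" for i x
    using Suc.prems that by (simp add: partial_derivative_def)
  have "Ck_on n k W (partial_derivative i (\<lambda>x. f x + g x))" if "i < n" for i
    using Suc.prems that by (intro Ck_on_cong[OF W d] Suc.IH) auto
  then show ?case using Suc.prems by (auto intro: continuous_on_add)
qed (auto intro: continuous_on_add)

lemma Ck_on_mult:
  fixes f g :: "(nat \<Rightarrow> real) \<Rightarrow> 'b::real_normed_algebra"
  assumes W: "openin (Euclidean_space n) W" and "Ck_on n k W f" "Ck_on n k W g"
  shows "Ck_on n k W (\<lambda>x. f x * g x)"
  using assms(2,3)
proof (induction k arbitrary: f g)
  case (Suc k)
  have d: "f x * partial_derivative i g x + partial_derivative i f x * g x = partial_derivative i (\<lambda>x. f x * g x) x"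
    if "i < n" "x \<in> W" for i x
    using Suc.prems that by (simp add: partial_derivative_def)
  have "Ck_on n k W (partial_derivative i (\<lambda>x. f x * g x))" if "i < n" for i
    using Suc.prems that Ck_on_mono[of n k W f] Ck_on_mono[of n k W g]
    by (intro Ck_on_cong[OF W d] Ck_on_add[OF W] Suc.IH) auto
  then show ?case using Suc.prems by (auto intro: continuous_on_mult differentiable_mult)
qed (auto intro: continuous_on_mult)

lemma smooth_fun_const [simp]: "smooth_fun (\<lambda>x. c)"
  by (simp add: smooth_fun_def smooth_on_def Ck_on_const case_prod_beta)

lemma smooth_fun_add: "smooth_fun f \<Longrightarrow> smooth_fun g \<Longrightarrow> smooth_fun (\<lambda>x. f x + g x)"
  unfolding smooth_fun_def smooth_on_def by (auto intro!: Ck_on_add chart_image_open)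

lemma smooth_fun_mult: "smooth_fun f \<Longrightarrow> smooth_fun g \<Longrightarrow> smooth_fun (\<lambda>x. f x * g x)"
  unfolding smooth_fun_def smooth_on_def by (auto intro!: Ck_on_mult chart_image_open)

lemma smooth_fun_cmult: "smooth_fun f \<Longrightarrow> smooth_fun (\<lambda>x. c * f x)"
  by (intro smooth_fun_mult) simp_all

lemma smooth_fun_minus: "smooth_fun f \<Longrightarrow> smooth_fun (\<lambda>x. - f x)"
  using smooth_fun_cmult[of f "-1"] by simp

lemma smooth_fun_diff: "smooth_fun f \<Longrightarrow> smooth_fun g \<Longrightarrow> smooth_fun (\<lambda>x. f x - g x)"
  using smooth_fun_add[OF _ smooth_fun_minus, of f g] by simp

class complex_vector = ab_group_add +
  fixes scaleC :: "complex \<Rightarrow> 'a \<Rightarrow> 'a"  (infixr "*\<^sub>C" 75)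
  assumes scaleC_right_distrib: "c *\<^sub>C (x + y) = c *\<^sub>C x + c *\<^sub>C y"
    and scaleC_left_distrib: "(c + d) *\<^sub>C x = c *\<^sub>C x + d *\<^sub>C x"
    and scaleC_scaleC [simp]: "c *\<^sub>C (d *\<^sub>C x) = (c * d) *\<^sub>C x"
    and scaleC_one [simp]: "1 *\<^sub>C x = x"

global_interpretation complex_vector: vector_space "scaleC :: complex \<Rightarrow> 'a \<Rightarrow> 'a::complex_vector"
  by unfold_locales (simp_all add: scaleC_right_distrib scaleC_left_distrib)

class complex_algebra_1 = complex_vector + ring_1 +
  assumes mult_scaleC_left [simp]: "(c *\<^sub>C x) * y = c *\<^sub>C (x * y)"
    and mult_scaleC_right [simp]: "x * (c *\<^sub>C y) = c *\<^sub>C (x * y)"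

class complex_lie_algebra = complex_vector +
  fixes lie :: "'a \<Rightarrow> 'a \<Rightarrow> 'a"
  assumes lie_add_left: "lie (x + y) z = lie x z + lie y z"
    and lie_add_right: "lie z (x + y) = lie z x + lie z y"
    and lie_scaleC_left: "lie (c *\<^sub>C x) y = c *\<^sub>C lie x y"
    and lie_scaleC_right: "lie x (c *\<^sub>C y) = c *\<^sub>C lie x y"
    and lie_self [simp]: "lie x x = 0"
    and lie_jacobi: "lie x (lie y z) + lie y (lie z x) + lie z (lie x y) = 0"

instantiation complex :: complex_algebra_1
begin
definition scaleC_complex :: "complex \<Rightarrow> complex \<Rightarrow> complex" where "scaleC_complex c x = c * x"
instance by standard (simp_all add: scaleC_complex_def algebra_simps)
end

text \<open>
  Smooth vector fields are the derivations of the algebra of smooth complex-valued functions; they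
  are complex because of the factor \<open>\<i>\<close> in the twist.  Since functions in HOL are total, a derivation
  is made to vanish on the functions that are not smooth.
\<close>

definition derivation :: "(('m::smooth_manifold \<Rightarrow> complex) \<Rightarrow> 'm \<Rightarrow> complex) \<Rightarrow> bool"
  where "derivation D \<longleftrightarrow>
    (\<forall>f. \<not> smooth_fun f \<longrightarrow> D f = (\<lambda>x. 0)) \<and>
    (\<forall>f. smooth_fun f \<longrightarrow> smooth_fun (D f)) \<and>
    (\<forall>f g. smooth_fun f \<longrightarrow> smooth_fun g \<longrightarrow> D (\<lambda>x. f x + g x) = (\<lambda>x. D f x + D g x)) \<and>
    (\<forall>c f. smooth_fun f \<longrightarrow> D (\<lambda>x. c * f x) = (\<lambda>x. c * D f x)) \<and>
    (\<forall>f g. smooth_fun f \<longrightarrow> smooth_fun g \<longrightarrow> D (\<lambda>x. f x * g x) = (\<lambda>x. D f x * g x + f x * D g x))"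

lemma derivationI:
  assumes "\<And>f x. \<not> smooth_fun f \<Longrightarrow> D f x = 0"
    and "\<And>f. smooth_fun f \<Longrightarrow> smooth_fun (D f)"
    and "\<And>f g x. smooth_fun f \<Longrightarrow> smooth_fun g \<Longrightarrow> D (\<lambda>x. f x + g x) x = D f x + D g x"
    and "\<And>c f x. smooth_fun f \<Longrightarrow> D (\<lambda>x. c * f x) x = c * D f x"
    and "\<And>f g x. smooth_fun f \<Longrightarrow> smooth_fun g \<Longrightarrow> D (\<lambda>x. f x * g x) x = D f x * g x + f x * D g x"
  shows "derivation D"
  unfolding derivation_def by (intro conjI allI impI ext; (rule assms; assumption))

lemma derivationD:
  assumes "derivation D"
  shows "\<not> smooth_fun f \<Longrightarrow> D f x = 0"
    and "smooth_fun f \<Longrightarrow> smooth_fun (D f)"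
    and "smooth_fun f \<Longrightarrow> smooth_fun g \<Longrightarrow> D (\<lambda>x. f x + g x) x = D f x + D g x"
    and "smooth_fun f \<Longrightarrow> D (\<lambda>x. c * f x) x = c * D f x"
    and "smooth_fun f \<Longrightarrow> smooth_fun g \<Longrightarrow> D (\<lambda>x. f x * g x) x = D f x * g x + f x * D g x"
  using assms by (simp_all add: derivation_def)

lemma derivation_zero_fun: "derivation D \<Longrightarrow> D (\<lambda>x. 0) = (\<lambda>x. 0)"
proof -
  assume "derivation D"
  moreover have "smooth_fun (\<lambda>x::'a. 0)" by simp
  ultimately have "D (\<lambda>x. 0 * 0) = (\<lambda>x. 0 * D (\<lambda>x. 0) x)" unfolding derivation_def by blast
  then show ?thesis by simp
qed

lemma derivation_apply_add:
  "derivation D \<Longrightarrow> derivation E \<Longrightarrow> derivation F \<Longrightarrow>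
     D (\<lambda>x. E f x + F f x) = (\<lambda>x. D (E f) x + D (F f) x)"
  by (cases "smooth_fun f") (simp_all add: derivation_def derivation_zero_fun)

lemma derivation_apply_cmult:
  "derivation D \<Longrightarrow> derivation E \<Longrightarrow> D (\<lambda>x. c * E f x) = (\<lambda>x. c * D (E f) x)"
  by (cases "smooth_fun f") (simp_all add: derivation_def derivation_zero_fun)

lemma derivation_compose_diff:
  assumes D: "derivation D" and E: "derivation E" and F: "derivation F"
  shows "D (\<lambda>x. E (F f) x - F (E f) x) = (\<lambda>x. D (E (F f)) x - D (F (E f)) x)"
proof (cases "smooth_fun f")
  case True
  then have s: "smooth_fun (E (F f))" "smooth_fun (F (E f))" using E F by (auto simp: derivation_def)
  have "D (\<lambda>x. E (F f) x + (-1) * F (E f) x) = (\<lambda>x. D (E (F f)) x + D (\<lambda>x. (-1) * F (E f) x) x)"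
    using D s smooth_fun_cmult[OF s(2), of "-1"] unfolding derivation_def by blast
  also have "D (\<lambda>x. (-1) * F (E f) x) = (\<lambda>x. (-1) * D (F (E f)) x)"
    using D s unfolding derivation_def by blast
  finally show ?thesis by simp
next
  case False
  then have "E f = (\<lambda>x. 0)" "F f = (\<lambda>x. 0)" using E F by (auto simp: derivation_def)
  then show ?thesis using D E F by (simp add: derivation_zero_fun)
qed

lemma derivation_commutator:
  fixes D E :: "('m::smooth_manifold \<Rightarrow> complex) \<Rightarrow> 'm \<Rightarrow> complex"
  assumes D: "derivation D" and E: "derivation E"
  shows "derivation (\<lambda>f x. D (E f) x - E (D f) x)"
proof -
  have sD: "smooth_fun (D f)" and sE: "smooth_fun (E f)" if "smooth_fun f" for f
    using that by (simp_all add: derivationD(2)[OF D] derivationD(2)[OF E])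
  have prod: "G (\<lambda>x. f x * g x) = (\<lambda>x. G f x * g x + f x * G g x)"
    and sum: "G (\<lambda>x. f x + g x) = (\<lambda>x. G f x + G g x)"
    if "derivation G" "smooth_fun f" "smooth_fun g"
    for G :: "('m \<Rightarrow> complex) \<Rightarrow> 'm \<Rightarrow> complex" and f g
    using derivationD(5)[OF that] derivationD(3)[OF that] by (simp_all add: fun_eq_iff)
  have cmult: "G (\<lambda>x. c * f x) = (\<lambda>x. c * G f x)" if "derivation G" "smooth_fun f"
    for G :: "('m \<Rightarrow> complex) \<Rightarrow> 'm \<Rightarrow> complex" and c f
    using derivationD(4)[OF that] by (simp add: fun_eq_iff)
  show ?thesis
    unfolding derivation_def
  proof (intro conjI allI impI)
    fix f :: "'m \<Rightarrow> complex" assume "\<not> smooth_fun f"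
    then have "D f = (\<lambda>x. 0)" "E f = (\<lambda>x. 0)"
      by (simp_all add: fun_eq_iff derivationD(1)[OF D] derivationD(1)[OF E])
    then show "(\<lambda>x. D (E f) x - E (D f) x) = (\<lambda>x. 0)" using D E by (simp add: derivation_zero_fun)
  next
    fix f :: "'m \<Rightarrow> complex" assume "smooth_fun f"
    then show "smooth_fun (\<lambda>x. D (E f) x - E (D f) x)" by (intro smooth_fun_diff sD sE)
  next
    fix f g :: "'m \<Rightarrow> complex" assume f: "smooth_fun f" and g: "smooth_fun g"
    show "(\<lambda>x. D (E (\<lambda>x. f x + g x)) x - E (D (\<lambda>x. f x + g x)) x) =
          (\<lambda>x. D (E f) x - E (D f) x + (D (E g) x - E (D g) x))"
      using sum[OF D f g] sum[OF E f g] sum[OF E sD[OF f] sD[OF g]] sum[OF D sE[OF f] sE[OF g]]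
      by (simp add: algebra_simps)
    have "D (E (\<lambda>x. f x * g x)) = (\<lambda>x. D (E f) x * g x + E f x * D g x + (D f x * E g x + f x * D (E g) x))"
      using prod[OF E f g] prod[OF D sE[OF f] g] prod[OF D f sE[OF g]]
        sum[OF D smooth_fun_mult[OF sE[OF f] g] smooth_fun_mult[OF f sE[OF g]]] by simp
    moreover have "E (D (\<lambda>x. f x * g x)) = (\<lambda>x. E (D f) x * g x + D f x * E g x + (E f x * D g x + f x * E (D g) x))"
      using prod[OF D f g] prod[OF E sD[OF f] g] prod[OF E f sD[OF g]]
        sum[OF E smooth_fun_mult[OF sD[OF f] g] smooth_fun_mult[OF f sD[OF g]]] by simp
    ultimately show "(\<lambda>x. D (E (\<lambda>x. f x * g x)) x - E (D (\<lambda>x. f x * g x)) x) =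
          (\<lambda>x. (D (E f) x - E (D f) x) * g x + f x * (D (E g) x - E (D g) x))"
      by (simp add: algebra_simps)
  next
    fix c and f :: "'m \<Rightarrow> complex" assume f: "smooth_fun f"
    show "(\<lambda>x. D (E (\<lambda>x. c * f x)) x - E (D (\<lambda>x. c * f x)) x) =
          (\<lambda>x. c * (D (E f) x - E (D f) x))"
      using cmult[OF D f] cmult[OF E f] cmult[OF E sD[OF f]] cmult[OF D sE[OF f]]
      by (simp add: algebra_simps)
  qed
qed

typedef (overloaded) ('m::smooth_manifold) vector_field =
  "{D :: ('m \<Rightarrow> complex) \<Rightarrow> 'm \<Rightarrow> complex. derivation D}"
  morphisms lie_derivative Abs_vector_field
  by (rule exI[of _ "\<lambda>f x. 0"]) (auto intro: derivationI)

setup_lifting type_definition_vector_field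

instantiation vector_field :: (smooth_manifold) complex_lie_algebra
begin

lift_definition zero_vector_field :: "'a vector_field" is "\<lambda>f x. 0"
  by (rule derivationI) simp_all
lift_definition plus_vector_field :: "'a vector_field \<Rightarrow> 'a vector_field \<Rightarrow> 'a vector_field"
  is "\<lambda>D E f x. D f x + E f x"
  subgoal premises d for D E
  proof (rule derivationI, goal_cases)
    case (1 f) then show ?case by (simp add: derivationD(1)[OF d(1)] derivationD(1)[OF d(2)])
  next
    case (2 f) then show ?case by (intro smooth_fun_add derivationD(2)[OF d(1)] derivationD(2)[OF d(2)])
  next
    case (3 f g) show ?case by (simp only: derivationD(3)[OF d(1) 3] derivationD(3)[OF d(2) 3]) (simp add: algebra_simps)
  next
    case (4 c f) show ?case by (simp only: derivationD(4)[OF d(1) 4] derivationD(4)[OF d(2) 4]) (simp add: algebra_simps)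
  next
    case (5 f g) show ?case by (simp only: derivationD(5)[OF d(1) 5] derivationD(5)[OF d(2) 5]) (simp add: algebra_simps)
  qed
  done
lift_definition minus_vector_field :: "'a vector_field \<Rightarrow> 'a vector_field \<Rightarrow> 'a vector_field"
  is "\<lambda>D E f x. D f x - E f x"
  subgoal premises d for D E
  proof (rule derivationI, goal_cases)
    case (1 f) then show ?case by (simp add: derivationD(1)[OF d(1)] derivationD(1)[OF d(2)])
  next
    case (2 f) then show ?case by (intro smooth_fun_diff derivationD(2)[OF d(1)] derivationD(2)[OF d(2)])
  next
    case (3 f g) show ?case by (simp only: derivationD(3)[OF d(1) 3] derivationD(3)[OF d(2) 3]) (simp add: algebra_simps)
  next
    case (4 c f) show ?case by (simp only: derivationD(4)[OF d(1) 4] derivationD(4)[OF d(2) 4]) (simp add: algebra_simps)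
  next
    case (5 f g) show ?case by (simp only: derivationD(5)[OF d(1) 5] derivationD(5)[OF d(2) 5]) (simp add: algebra_simps)
  qed
  done
lift_definition uminus_vector_field :: "'a vector_field \<Rightarrow> 'a vector_field"
  is "\<lambda>D f x. - D f x"
  subgoal premises d for D
  proof (rule derivationI, goal_cases)
    case (1 f) then show ?case by (simp add: derivationD(1)[OF d])
  next
    case (2 f) then show ?case by (intro smooth_fun_minus derivationD(2)[OF d])
  next
    case (3 f g) show ?case by (simp only: derivationD(3)[OF d 3]) (simp add: algebra_simps)
  next
    case (4 b f) show ?case by (simp only: derivationD(4)[OF d 4]) (simp add: algebra_simps)
  next
    case (5 f g) show ?case by (simp only: derivationD(5)[OF d 5]) (simp add: algebra_simps)
  qed
  done
lift_definition scaleC_vector_field :: "complex \<Rightarrow> 'a vector_field \<Rightarrow> 'a vector_field"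
  is "\<lambda>c D f x. c * D f x"
  subgoal premises d for c D
  proof (rule derivationI, goal_cases)
    case (1 f) then show ?case by (simp add: derivationD(1)[OF d])
  next
    case (2 f) then show ?case by (intro smooth_fun_cmult derivationD(2)[OF d])
  next
    case (3 f g) show ?case by (simp only: derivationD(3)[OF d 3]) (simp add: algebra_simps)
  next
    case (4 b f) show ?case by (simp only: derivationD(4)[OF d 4]) (simp add: algebra_simps)
  next
    case (5 f g) show ?case by (simp only: derivationD(5)[OF d 5]) (simp add: algebra_simps)
  qed
  done
lift_definition lie_vector_field :: "'a vector_field \<Rightarrow> 'a vector_field \<Rightarrow> 'a vector_field"
  is "\<lambda>D E f x. D (E f) x - E (D f) x"
  by (rule derivation_commutator)

instance
  by (standard; transfer)
    (auto simp: fun_eq_iff algebra_simps derivation_apply_add derivation_apply_cmult derivation_compose_diff)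

end


abbreviation lookup where "lookup \<equiv> Poly_Mapping.lookup"
abbreviation single where "single \<equiv> Poly_Mapping.single"
abbreviation keys where "keys \<equiv> Poly_Mapping.keys"

instantiation poly_mapping :: (type, complex_vector) complex_vector
begin
lift_definition scaleC_poly_mapping :: "complex \<Rightarrow> ('a \<Rightarrow>\<^sub>0 'b) \<Rightarrow> 'a \<Rightarrow>\<^sub>0 'b"
  is "\<lambda>c f k. c *\<^sub>C f k"
  by (rule finite_subset[rotated]) auto
instance
  by (standard; transfer) (simp_all add: fun_eq_iff scaleC_right_distrib scaleC_left_distrib)
end

lemma single_scaleC: "single k (c * d) = c *\<^sub>C single k (d::complex)"
  by (rule poly_mapping_eqI) (simp add: scaleC_poly_mapping.rep_eq lookup_single scaleC_complex_def when_def)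


text \<open>
  \<open>'k \<Rightarrow>\<^sub>0 complex\<close> is the complex vector space with basis \<open>'k\<close>, embedded by \<open>k \<mapsto> single k 1\<close>.
\<close>

definition linear_extension :: "('k \<Rightarrow> 'v::complex_vector) \<Rightarrow> ('k \<Rightarrow>\<^sub>0 complex) \<Rightarrow> 'v"
  where "linear_extension f p = (\<Sum>k\<in>keys p. lookup p k *\<^sub>C f k)"

lemma linear_extension_superset:
  "finite A \<Longrightarrow> keys p \<subseteq> A \<Longrightarrow> linear_extension f p = (\<Sum>k\<in>A. lookup p k *\<^sub>C f k)"
  unfolding linear_extension_def by (rule sum.mono_neutral_left) (auto simp: in_keys_iff)

lemma linear_extension_add: "linear_extension f (p + q) = linear_extension f p + linear_extension f q"
proof -
  have "finite (keys p \<union> keys q)" by simp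
  from linear_extension_superset[OF this, of "p + q" f, OF keys_add] linear_extension_superset[OF this, of p f]
    linear_extension_superset[OF this, of q f]
  show ?thesis by (simp add: lookup_add scaleC_left_distrib sum.distrib)
qed

lemma linear_extension_scaleC: "linear_extension f (c *\<^sub>C p) = c *\<^sub>C linear_extension f p"
proof -
  have "keys (c *\<^sub>C p) \<subseteq> keys p" by (auto simp: in_keys_iff scaleC_poly_mapping.rep_eq scaleC_complex_def)
  then show ?thesis
    by (subst linear_extension_superset[of "keys p"])
      (simp_all add: linear_extension_def complex_vector.scale_sum_right scaleC_poly_mapping.rep_eq scaleC_complex_def)
qed

lemma linear_extension_zero [simp]: "linear_extension f 0 = 0"
  by (simp add: linear_extension_def)

lemma linear_extension_uminus: "linear_extension f (- p) = - linear_extension f p"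
  using linear_extension_add[of f p "- p"] by (simp add: eq_neg_iff_add_eq_0 add.commute)

lemma linear_extension_diff: "linear_extension f (p - q) = linear_extension f p - linear_extension f q"
  using linear_extension_add[of f p "- q"] by (simp add: linear_extension_uminus)

lemma linear_extension_single [simp]: "linear_extension f (single k c) = c *\<^sub>C f k"
  by (simp add: linear_extension_def)

lemmas linear_extension_simps =
  linear_extension_add linear_extension_diff linear_extension_uminus linear_extension_scaleC

lemma poly_mapping_single_induct [case_names zero single add]:
  assumes "P 0" and "\<And>k c. P (single k c)" and "\<And>p q. P p \<Longrightarrow> P q \<Longrightarrow> P (p + q)"
  shows "P p"
proof (induction p rule: update_induct)
  case (update f a b)
  have "Poly_Mapping.update a b f = f + single a b"
    using update(1) by (intro poly_mapping_eqI) (auto simp: lookup_update lookup_add lookup_single in_keys_iff when_def)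
  then show ?case using assms update by simp
qed (use assms in simp)

lemma poly_mapping_mult_scaleC [simp]:
  fixes p q :: "'a::monoid_add \<Rightarrow>\<^sub>0 complex"
  shows "(c *\<^sub>C p) * q = c *\<^sub>C (p * q)" "p * (c *\<^sub>C q) = c *\<^sub>C (p * q)"
proof -
  have s: "single k (c::complex) = c *\<^sub>C single k 1" for k :: 'a and c
    using single_scaleC[of k c 1] by simp
  have 1: "c *\<^sub>C p = single 0 c * p" for p :: "'a \<Rightarrow>\<^sub>0 complex"
    by (induction p rule: poly_mapping_single_induct)
      (simp_all add: mult_single single_scaleC scaleC_right_distrib distrib_left)
  have 2: "c *\<^sub>C p = p * single 0 c" for p :: "'a \<Rightarrow>\<^sub>0 complex"
    by (induction p rule: poly_mapping_single_induct)
      (simp_all add: mult_single single_scaleC[symmetric] scaleC_right_distrib distrib_right mult.commute[of c])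
  show "(c *\<^sub>C p) * q = c *\<^sub>C (p * q)" using 1 by (simp add: mult.assoc)
  show "p * (c *\<^sub>C q) = c *\<^sub>C (p * q)" using 2 by (simp add: mult.assoc)
qed

text \<open>
  Words under concatenation: the wrapper lets \<open>'l word \<Rightarrow>\<^sub>0 complex\<close>, with the convolution product of
  \<^theory>\<open>HOL-Library.Poly_Mapping\<close>, be the free associative algebra on \<open>'l\<close>.  Dividing by the linear
  relations of \<open>'l\<close> and the commutator relations gives the universal enveloping algebra.
\<close>

datatype 'a word = Word (letters: "'a list")

instantiation word :: (type) monoid_add
begin
definition zero_word :: "'a word" where "zero_word = Word []"
definition plus_word :: "'a word \<Rightarrow> 'a word \<Rightarrow> 'a word" where "v + w = Word (letters v @ letters w)"
instance by standard (simp_all add: zero_word_def plus_word_def)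
end

lemma letters_word [simp]: "letters 0 = []" "letters (v + w) = letters v @ letters w"
  by (simp_all add: zero_word_def plus_word_def)

abbreviation letter :: "'l \<Rightarrow> 'l word \<Rightarrow>\<^sub>0 complex"
  where "letter u \<equiv> single (Word [u]) 1"

inductive_set uea_ideal :: "('l::complex_lie_algebra word \<Rightarrow>\<^sub>0 complex) set"
  where
    linear: "letter (c *\<^sub>C u + v) - (c *\<^sub>C letter u + letter v) \<in> uea_ideal"
  | commutator: "letter u * letter v - letter v * letter u - letter (lie u v) \<in> uea_ideal"
  | add: "x \<in> uea_ideal \<Longrightarrow> y \<in> uea_ideal \<Longrightarrow> x + y \<in> uea_ideal"
  | mult_left: "x \<in> uea_ideal \<Longrightarrow> a * x \<in> uea_ideal"
  | mult_right: "x \<in> uea_ideal \<Longrightarrow> x * a \<in> uea_ideal"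

lemma uea_ideal_zero: "0 \<in> uea_ideal"
  using uea_ideal.mult_left[OF uea_ideal.commutator, of 0] by simp

lemma uea_ideal_uminus: "x \<in> uea_ideal \<Longrightarrow> - x \<in> uea_ideal"
  using uea_ideal.mult_left[of x "-1"] by simp

lemma uea_ideal_scaleC: "x \<in> uea_ideal \<Longrightarrow> c *\<^sub>C x \<in> uea_ideal"
  using uea_ideal.mult_left[of x "c *\<^sub>C 1"] by simp

definition uea_rel :: "('l::complex_lie_algebra word \<Rightarrow>\<^sub>0 complex) \<Rightarrow> ('l word \<Rightarrow>\<^sub>0 complex) \<Rightarrow> bool"
  where "uea_rel x y \<longleftrightarrow> x - y \<in> uea_ideal"

lemma uea_rel_equivp: "equivp (uea_rel :: ('l::complex_lie_algebra word \<Rightarrow>\<^sub>0 complex) \<Rightarrow> _)"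
proof (rule equivpI)
  show "reflp (uea_rel :: ('l word \<Rightarrow>\<^sub>0 complex) \<Rightarrow> _)" by (rule reflpI) (simp add: uea_rel_def uea_ideal_zero)
  show "symp (uea_rel :: ('l word \<Rightarrow>\<^sub>0 complex) \<Rightarrow> _)"
    by (rule sympI) (metis uea_rel_def minus_diff_eq uea_ideal_uminus)
  show "transp (uea_rel :: ('l word \<Rightarrow>\<^sub>0 complex) \<Rightarrow> _)"
  proof (rule transpI)
    fix x y z :: "'l word \<Rightarrow>\<^sub>0 complex" assume "uea_rel x y" "uea_rel y z"
    then show "uea_rel x z" using uea_ideal.add[of "x - y" "y - z"] by (simp add: uea_rel_def)
  qed
qed

quotient_type (overloaded) 'l uea = "'l::complex_lie_algebra word \<Rightarrow>\<^sub>0 complex" / uea_rel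
  by (rule uea_rel_equivp)

lemma uea_empty_word_coeff: "x \<in> uea_ideal \<Longrightarrow> linear_extension (\<lambda>w. if letters w = [] then 1 else (0::complex)) x = 0"
proof -
  define e :: "('a word \<Rightarrow>\<^sub>0 complex) \<Rightarrow> complex"
    where "e = linear_extension (\<lambda>w. if letters w = [] then 1 else 0)"
  have m: "e (x * y) = e x * e y" for x y
  proof (induction x rule: poly_mapping_single_induct)
    case (single k c)
    show ?case
      by (induction y rule: poly_mapping_single_induct)
        (auto simp: e_def mult_single scaleC_complex_def distrib_left linear_extension_add)
  qed (auto simp: e_def distrib_right linear_extension_add)
  show "e x = 0" if "x \<in> uea_ideal"
    using that
  proof induction
    case (linear c u v)
    show ?case by (simp add: e_def linear_extension_simps scaleC_complex_def)
  next
    case (commutator u v)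
    show ?case by (simp add: e_def linear_extension_simps scaleC_complex_def mult_single)
  next
    case (add x y)
    then show ?case by (simp add: e_def linear_extension_add)
  qed (simp_all add: m)
qed

instantiation uea :: (complex_lie_algebra) complex_algebra_1
begin

lift_definition zero_uea :: "'a uea" is 0 .
lift_definition one_uea :: "'a uea" is 1 .
lift_definition plus_uea :: "'a uea \<Rightarrow> 'a uea \<Rightarrow> 'a uea" is "(+)"
  unfolding uea_rel_def by (simp only: add_diff_add uea_ideal.add)
lift_definition uminus_uea :: "'a uea \<Rightarrow> 'a uea" is uminus
  unfolding uea_rel_def using uea_ideal_uminus by fastforce
lift_definition minus_uea :: "'a uea \<Rightarrow> 'a uea \<Rightarrow> 'a uea" is "(-)"
proof -
  fix x y z w :: "'a word \<Rightarrow>\<^sub>0 complex"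
  assume "uea_rel x y" "uea_rel z w"
  then have "(x - y) + - (z - w) \<in> uea_ideal" unfolding uea_rel_def by (intro uea_ideal.add uea_ideal_uminus)
  then show "uea_rel (x - z) (y - w)" by (simp add: uea_rel_def algebra_simps)
qed
lift_definition times_uea :: "'a uea \<Rightarrow> 'a uea \<Rightarrow> 'a uea" is "(*)"
proof -
  fix x y z w :: "'a word \<Rightarrow>\<^sub>0 complex"
  assume "uea_rel x y" "uea_rel z w"
  then have "(x - y) * z + y * (z - w) \<in> uea_ideal"
    unfolding uea_rel_def by (intro uea_ideal.add uea_ideal.mult_left uea_ideal.mult_right)
  then show "uea_rel (x * z) (y * w)" by (simp add: uea_rel_def algebra_simps)
qed
lift_definition scaleC_uea :: "complex \<Rightarrow> 'a uea \<Rightarrow> 'a uea" is "(*\<^sub>C)"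
  unfolding uea_rel_def
  by (metis complex_vector.scale_right_diff_distrib uea_ideal_scaleC)

instance
proof
  have "(1 :: 'a word \<Rightarrow>\<^sub>0 complex) \<notin> uea_ideal"
    using uea_empty_word_coeff[of "1 :: 'a word \<Rightarrow>\<^sub>0 complex"]
    by (auto simp: single_one[symmetric] simp del: single_one)
  then show "(0 :: 'a uea) \<noteq> 1"
    by transfer (auto simp: uea_rel_def dest: uea_ideal_uminus)
qed (transfer; simp add: uea_rel_def uea_ideal_zero algebra_simps scaleC_right_distrib scaleC_left_distrib)+

end

lift_definition uea_of :: "'l::complex_lie_algebra \<Rightarrow> 'l uea" is letter .

lemma uea_of_linear: "uea_of (c *\<^sub>C u + v) = c *\<^sub>C uea_of u + uea_of v"
  by transfer (simp add: uea_rel_def uea_ideal.linear)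

lemma uea_of_lie: "uea_of (lie u v) = uea_of u * uea_of v - uea_of v * uea_of u"
proof -
  have "uea_of u * uea_of v - uea_of v * uea_of u = uea_of (lie u v)"
    by transfer (simp add: uea_rel_def uea_ideal.commutator)
  then show ?thesis by simp
qed

abbreviation free_antipode :: "('l word \<Rightarrow>\<^sub>0 complex) \<Rightarrow> 'l word \<Rightarrow>\<^sub>0 complex"
  where "free_antipode \<equiv> linear_extension (\<lambda>w. single (Word (rev (letters w))) ((-1) ^ length (letters w)))"

lemma free_antipode_mult: "free_antipode (x * y) = free_antipode y * free_antipode x"
proof (induction x rule: poly_mapping_single_induct)
  case (single k c)
  show ?case
    by (induction y rule: poly_mapping_single_induct)
      (simp_all add: mult_single linear_extension_add distrib_left distrib_right plus_word_def
        scaleC_right_distrib power_add mult.commute)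
qed (simp_all add: linear_extension_add distrib_left distrib_right)

lemma free_antipode_ideal: "x \<in> uea_ideal \<Longrightarrow> free_antipode x \<in> uea_ideal"
proof (induction rule: uea_ideal.induct)
  case (linear c u v)
  have "- (letter (c *\<^sub>C u + v) - (c *\<^sub>C letter u + letter v)) \<in> uea_ideal"
    by (intro uea_ideal_uminus uea_ideal.linear)
  then show ?case by (simp add: linear_extension_simps single_uminus algebra_simps)
next
  case (commutator u v)
  have "- (letter u * letter v - letter v * letter u - letter (lie u v)) \<in> uea_ideal"
    by (intro uea_ideal_uminus uea_ideal.commutator)
  then show ?case by (simp add: linear_extension_simps single_uminus mult_single plus_word_def algebra_simps)
next
  case (add x y)
  then show ?case by (simp add: linear_extension_add uea_ideal.add)
qed (simp_all add: free_antipode_mult uea_ideal.mult_left uea_ideal.mult_right)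

lift_definition antipode :: "'l::complex_lie_algebra uea \<Rightarrow> 'l uea" is free_antipode
  unfolding uea_rel_def linear_extension_diff[symmetric] by (rule free_antipode_ideal)

lemma antipode_uea_of: "antipode (uea_of u) = - uea_of u"
  by transfer (simp add: uea_rel_def uea_ideal_zero single_uminus)

lemma antipode_mult: "antipode (x * y) = antipode y * antipode x"
  by transfer (simp add: uea_rel_def uea_ideal_zero free_antipode_mult)

lemma antipode_one: "antipode 1 = 1"
  by transfer (simp add: uea_rel_def uea_ideal_zero single_one[symmetric] zero_word_def del: single_one)

text \<open>
  The action of the enveloping algebra on the Lie algebra that extends the adjoint action
  \<open>u \<mapsto> lie v u\<close>.
\<close>

abbreviation free_act :: "('l::complex_lie_algebra word \<Rightarrow>\<^sub>0 complex) \<Rightarrow> 'l \<Rightarrow> 'l"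
  where "free_act x u \<equiv> linear_extension (\<lambda>w. foldr lie (letters w) u) x"

lemma lie_zero [simp]: "lie x 0 = 0" "lie 0 x = (0::'l::complex_lie_algebra)"
  using lie_add_right[of x 0 0] lie_add_left[of 0 0 x] by simp_all

lemma lie_uminus: "lie x (- y) = - lie x (y::'l::complex_lie_algebra)" "lie (- x) y = - lie x y"
proof -
  have "lie x y + lie x (- y) = 0" "lie x y + lie (- x) y = 0"
    by (simp_all flip: lie_add_right lie_add_left)
  then show "lie x (- y) = - lie x y" "lie (- x) y = - lie x y"
    using minus_unique by metis+
qed

lemma lie_anticommute: "lie y x = - lie x (y::'l::complex_lie_algebra)"
proof -
  have "lie x y + lie y x = 0"
    using lie_add_left[of x y "x + y"] by (simp add: lie_add_right)
  then show ?thesis using minus_unique by metis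
qed

lemma foldr_lie_linear:
  "foldr lie w (u + v) = foldr lie w u + foldr lie w (v::'l::complex_lie_algebra)"
  "foldr lie w (c *\<^sub>C u) = c *\<^sub>C foldr lie w u"
  by (induction w) (simp_all add: lie_add_right lie_scaleC_right)

lemma free_act_linear:
  "free_act x (u + v) = free_act x u + free_act x v"
  "free_act x (c *\<^sub>C u) = c *\<^sub>C free_act x u"
  by (induction x rule: poly_mapping_single_induct)
    (simp_all add: linear_extension_add foldr_lie_linear scaleC_right_distrib add_ac mult.commute)

lemma free_act_zero: "free_act x 0 = 0"
  using free_act_linear(2)[where c = 0 and u = 0 and x = x] by simp

lemma free_act_mult: "free_act (x * y) u = free_act x (free_act y u)"
proof (induction y rule: poly_mapping_single_induct)
  case zero
  show ?case by (simp add: free_act_zero)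
next
  case (single k c)
  show ?case
    by (induction x rule: poly_mapping_single_induct)
      (simp_all add: mult_single linear_extension_add distrib_right foldr_lie_linear)
qed (simp add: linear_extension_add distrib_left free_act_linear)

lemma free_act_ideal: "x \<in> uea_ideal \<Longrightarrow> free_act x u = 0"
proof (induction arbitrary: u rule: uea_ideal.induct)
  case (linear c v w)
  show ?case by (simp add: linear_extension_simps lie_add_left lie_scaleC_left)
next
  case (commutator v w)
  show ?case
    using lie_jacobi[of v w u] lie_anticommute[of u v] lie_anticommute[of "lie v w" u]
    by (simp add: linear_extension_simps free_act_mult lie_uminus algebra_simps)
next
  case (mult_left x a)
  then show ?case by (simp add: free_act_mult free_act_zero)
qed (simp_all add: linear_extension_add free_act_mult)

lift_definition uea_act :: "'l::complex_lie_algebra uea \<Rightarrow> 'l \<Rightarrow> 'l" is free_act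
  subgoal for x y
    using free_act_ideal[of "x - y"] by (simp add: uea_rel_def linear_extension_diff fun_eq_iff)
  done

lemma uea_act_uea_of: "uea_act (uea_of v) u = lie v u"
  by transfer simp

lemma uea_act_mult: "uea_act (x * y) u = uea_act x (uea_act y u)"
  by transfer (rule free_act_mult)

lemma uea_act_one: "uea_act 1 u = u"
  by transfer (simp add: single_one[symmetric] del: single_one)

lemma uea_act_linear:
  "uea_act (x + y) u = uea_act x u + uea_act y u"
  "uea_act (c *\<^sub>C x) u = c *\<^sub>C uea_act x u"
  "uea_act x (u + v) = uea_act x u + uea_act x v"
  "uea_act x (c *\<^sub>C u) = c *\<^sub>C uea_act x u"
  by (transfer; simp add: linear_extension_simps free_act_linear)+


definition complex_bilinear :: "('a::complex_vector \<Rightarrow> 'b::complex_vector \<Rightarrow> 'v::complex_vector) \<Rightarrow> bool"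
  where "complex_bilinear B \<longleftrightarrow>
    (\<forall>c x x' y. B (c *\<^sub>C x + x') y = c *\<^sub>C B x y + B x' y) \<and>
    (\<forall>c x y y'. B x (c *\<^sub>C y + y') = c *\<^sub>C B x y + B x y')"

definition tensor_relations :: "('a::complex_vector \<times> 'b::complex_vector \<Rightarrow>\<^sub>0 complex) set"
  where "tensor_relations =
    {single (c *\<^sub>C x + x', y) 1 - (c *\<^sub>C single (x, y) 1 + single (x', y) 1) |c x x' y. True} \<union>
    {single (x, c *\<^sub>C y + y') 1 - (c *\<^sub>C single (x, y) 1 + single (x, y') 1) |c x y y'. True}"

definition tensor_rel ::
    "('a::complex_vector \<times> 'b::complex_vector \<Rightarrow>\<^sub>0 complex) \<Rightarrow> ('a \<times> 'b \<Rightarrow>\<^sub>0 complex) \<Rightarrow> bool"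
  where "tensor_rel x y \<longleftrightarrow> x - y \<in> complex_vector.span tensor_relations"

lemma tensor_rel_equivp:
  "equivp (tensor_rel :: ('a::complex_vector \<times> 'b::complex_vector \<Rightarrow>\<^sub>0 complex) \<Rightarrow> _)"
proof (rule equivpI)
  show "reflp (tensor_rel :: ('a \<times> 'b \<Rightarrow>\<^sub>0 complex) \<Rightarrow> _)"
    by (rule reflpI) (simp add: tensor_rel_def complex_vector.span_zero)
  show "symp (tensor_rel :: ('a \<times> 'b \<Rightarrow>\<^sub>0 complex) \<Rightarrow> _)"
    by (rule sympI) (metis tensor_rel_def minus_diff_eq complex_vector.span_neg)
  show "transp (tensor_rel :: ('a \<times> 'b \<Rightarrow>\<^sub>0 complex) \<Rightarrow> _)"
  proof (rule transpI)
    fix x y z :: "'a \<times> 'b \<Rightarrow>\<^sub>0 complex" assume "tensor_rel x y" "tensor_rel y z"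
    then show "tensor_rel x z"
      using complex_vector.span_add[of "x - y" _ "y - z"] by (simp add: tensor_rel_def)
  qed
qed

quotient_type (overloaded) ('a, 'b) tensor =
    "'a::complex_vector \<times> 'b::complex_vector \<Rightarrow>\<^sub>0 complex" / tensor_rel
  by (rule tensor_rel_equivp)

instantiation tensor :: (complex_vector, complex_vector) complex_vector
begin

lift_definition zero_tensor :: "('a, 'b) tensor" is 0 .
lift_definition plus_tensor :: "('a, 'b) tensor \<Rightarrow> ('a, 'b) tensor \<Rightarrow> ('a, 'b) tensor" is "(+)"
  unfolding tensor_rel_def by (simp only: add_diff_add complex_vector.span_add)
lift_definition uminus_tensor :: "('a, 'b) tensor \<Rightarrow> ('a, 'b) tensor" is uminus
  unfolding tensor_rel_def using complex_vector.span_neg by fastforce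
lift_definition minus_tensor :: "('a, 'b) tensor \<Rightarrow> ('a, 'b) tensor \<Rightarrow> ('a, 'b) tensor" is "(-)"
proof -
  fix x y z w :: "'a \<times> 'b \<Rightarrow>\<^sub>0 complex"
  assume "tensor_rel x y" "tensor_rel z w"
  then have "(x - y) - (z - w) \<in> complex_vector.span tensor_relations"
    unfolding tensor_rel_def by (rule complex_vector.span_diff)
  then show "tensor_rel (x - z) (y - w)" by (simp add: tensor_rel_def algebra_simps)
qed
lift_definition scaleC_tensor :: "complex \<Rightarrow> ('a, 'b) tensor \<Rightarrow> ('a, 'b) tensor" is "(*\<^sub>C)"
  unfolding tensor_rel_def
  by (simp only: complex_vector.scale_right_diff_distrib[symmetric] complex_vector.span_scale)

instance
  by standard
    (transfer; simp add: tensor_rel_def complex_vector.span_zero algebra_simps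
      scaleC_right_distrib scaleC_left_distrib)+

end

lift_definition tensor :: "'a::complex_vector \<Rightarrow> 'b::complex_vector \<Rightarrow> ('a, 'b) tensor"  (infixr "\<otimes>" 75)
  is "\<lambda>x y. single (x, y) 1" .

text \<open>
  \<open>tensor_lift B\<close> is the linear map \<open>x \<otimes> y \<mapsto> B x y\<close>; the choice of the representative is immaterial when
  \<open>B\<close> is bilinear.
\<close>

definition tensor_lift ::
    "('a::complex_vector \<Rightarrow> 'b::complex_vector \<Rightarrow> 'v::complex_vector) \<Rightarrow> ('a, 'b) tensor \<Rightarrow> 'v"
  where "tensor_lift B T = linear_extension (\<lambda>(x, y). B x y) (rep_tensor T)"

lemma tensor_bilinear: "complex_bilinear (\<otimes>)"
  unfolding complex_bilinear_def
proof (intro conjI allI)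
  fix c and x x' :: 'a and y :: 'b
  show "(c *\<^sub>C x + x') \<otimes> y = c *\<^sub>C x \<otimes> y + x' \<otimes> y"
  proof transfer
    fix c and x x' :: 'a and y :: 'b
    show "tensor_rel (single (c *\<^sub>C x + x', y) 1) (c *\<^sub>C single (x, y) 1 + single (x', y) 1)"
      unfolding tensor_rel_def
      by (rule complex_vector.span_base) (unfold tensor_relations_def, blast)
  qed
next
  fix c and x :: 'a and y y' :: 'b
  show "x \<otimes> (c *\<^sub>C y + y') = c *\<^sub>C x \<otimes> y + x \<otimes> y'"
  proof transfer
    fix c and x :: 'a and y y' :: 'b
    show "tensor_rel (single (x, c *\<^sub>C y + y') 1) (c *\<^sub>C single (x, y) 1 + single (x, y') 1)"
      unfolding tensor_rel_def
      by (rule complex_vector.span_base) (unfold tensor_relations_def, blast)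
  qed
qed

lemma complex_bilinearD:
  assumes "complex_bilinear B"
  shows "B (x + x') y = B x y + B x' y" "B (c *\<^sub>C x) y = c *\<^sub>C B x y" "B 0 y = 0"
    and "B x (y + y') = B x y + B x y'" "B x (c *\<^sub>C y) = c *\<^sub>C B x y" "B x 0 = 0"
proof -
  have l: "B (c *\<^sub>C x + x') y = c *\<^sub>C B x y + B x' y" and r: "B x (c *\<^sub>C y + y') = c *\<^sub>C B x y + B x y'"
    for c x x' y y'
    using assms unfolding complex_bilinear_def by simp_all
  show zl: "B 0 y = 0" and zr: "B x 0 = 0" for x y
    using l[of "-1" 0 0 y] r[of x "-1" 0 0] by simp_all
  show "B (x + x') y = B x y + B x' y" "B x (y + y') = B x y + B x y'"
    using l[of 1 x x' y] r[of x 1 y y'] by simp_all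
  show "B (c *\<^sub>C x) y = c *\<^sub>C B x y" "B x (c *\<^sub>C y) = c *\<^sub>C B x y"
    using l[of c x 0 y] r[of x c y 0] by (simp_all add: zl zr)
qed

lemma complex_bilinearI:
  assumes "\<And>x x' y. B (x + x') y = B x y + B x' y" "\<And>c x y. B (c *\<^sub>C x) y = c *\<^sub>C B x y"
    and "\<And>x y y'. B x (y + y') = B x y + B x y'" "\<And>c x y. B x (c *\<^sub>C y) = c *\<^sub>C B x y"
  shows "complex_bilinear B"
  unfolding complex_bilinear_def by (simp add: assms)

lemma linear_extension_tensor_relations:
  assumes B: "complex_bilinear B" and "p \<in> complex_vector.span tensor_relations"
  shows "linear_extension (\<lambda>(x, y). B x y) p = 0"
  using assms(2)
proof (induction rule: complex_vector.span_induct_alt)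
  case (step c p q)
  have "linear_extension (\<lambda>(x, y). B x y) p = 0"
    using step(1) complex_bilinearD[OF B] by (auto simp: tensor_relations_def linear_extension_simps)
  then show ?case using step(2) by (simp add: linear_extension_simps)
qed simp

lemma tensor_lift_abs:
  assumes "complex_bilinear B"
  shows "tensor_lift B (abs_tensor p) = linear_extension (\<lambda>(x, y). B x y) p"
proof -
  have "tensor_rel (rep_tensor (abs_tensor p)) p"
    using Quotient3_rep_abs[OF Quotient3_tensor] tensor_rel_equivp by (metis equivp_reflp)
  then have "linear_extension (\<lambda>(x, y). B x y) (rep_tensor (abs_tensor p) - p) = 0"
    unfolding tensor_rel_def by (rule linear_extension_tensor_relations[OF assms])
  then show ?thesis by (simp add: tensor_lift_def linear_extension_simps)
qed

lemma tensor_lift_tensor: "complex_bilinear B \<Longrightarrow> tensor_lift B (x \<otimes> y) = B x y"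
  by (simp add: tensor.abs_eq tensor_lift_abs)

lemma tensor_abs_cases: obtains p where "T = abs_tensor p"
  using Quotient3_abs_rep[OF Quotient3_tensor, of T] by metis

lemma tensor_lift_add:
  "complex_bilinear B \<Longrightarrow> tensor_lift B (S + T) = tensor_lift B S + tensor_lift B T"
  by (cases S rule: tensor_abs_cases, cases T rule: tensor_abs_cases)
    (simp add: plus_tensor.abs_eq tensor_lift_abs linear_extension_simps)

lemma tensor_lift_scaleC: "complex_bilinear B \<Longrightarrow> tensor_lift B (c *\<^sub>C T) = c *\<^sub>C tensor_lift B T"
  by (cases T rule: tensor_abs_cases)
    (simp add: scaleC_tensor.abs_eq tensor_lift_abs linear_extension_simps)

lemma tensor_lift_zero: "complex_bilinear B \<Longrightarrow> tensor_lift B 0 = 0"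
  using tensor_lift_scaleC[of B 0 0] by simp

lemma tensor_lift_linear_in_map:
  "tensor_lift (\<lambda>x y. A x y + B x y) T = tensor_lift A T + tensor_lift B T"
  "tensor_lift (\<lambda>x y. c *\<^sub>C A x y) T = c *\<^sub>C tensor_lift A T"
  by (simp_all add: tensor_lift_def linear_extension_def case_prod_beta scaleC_right_distrib
      sum.distrib complex_vector.scale_sum_right mult.commute)

lemma tensor_induct [case_names tensor add]:
  assumes "\<And>x y. P (x \<otimes> y)" and "\<And>S T. P S \<Longrightarrow> P T \<Longrightarrow> P (S + T)"
  shows "P T"
proof (cases T rule: tensor_abs_cases)
  case (1 p)
  have "P (abs_tensor p)"
  proof (induction p rule: poly_mapping_single_induct)
    case zero
    have "P (0 \<otimes> 0)" by (rule assms)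
    then show ?case by (simp add: complex_bilinearD[OF tensor_bilinear] zero_tensor.abs_eq)
  next
    case (single k c)
    have "abs_tensor (single k c) = c *\<^sub>C abs_tensor (single k 1)"
      using single_scaleC[of k c 1] by (simp add: scaleC_tensor.abs_eq)
    also have "abs_tensor (single k 1) = fst k \<otimes> snd k"
      by (simp add: tensor.abs_eq)
    also have "c *\<^sub>C (fst k \<otimes> snd k) = (c *\<^sub>C fst k) \<otimes> snd k"
      by (simp add: complex_bilinearD[OF tensor_bilinear])
    finally have "abs_tensor (single k c) = (c *\<^sub>C fst k) \<otimes> snd k" .
    then show ?case using assms(1) by simp
  next
    case (add p q)
    then show ?case using assms(2) by (simp add: plus_tensor.abs_eq[symmetric])
  qed
  then show ?thesis by (simp add: 1)
qed

lemma complex_linear_functional_one: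
  obtains \<phi> :: "'a::complex_algebra_1 \<Rightarrow> complex"
  where "\<And>x y. \<phi> (x + y) = \<phi> x + \<phi> y" "\<And>c x. \<phi> (c *\<^sub>C x) = c * \<phi> x" "\<phi> 1 = 1"
proof -
  interpret vector_space_pair "scaleC :: complex \<Rightarrow> 'a \<Rightarrow> 'a" "(*) :: complex \<Rightarrow> complex \<Rightarrow> complex"
    by unfold_locales (simp_all add: algebra_simps)
  have "complex_vector.independent {1::'a}" by simp
  from linear_independent_extend[OF this, of "\<lambda>_. 1"] obtain \<phi> :: "'a \<Rightarrow> complex"
    where "Vector_Spaces.linear (*\<^sub>C) (*) \<phi>" "\<phi> 1 = 1" by auto
  then show thesis using linear_add linear_scale by (intro that[of \<phi>]) auto
qed

instantiation tensor :: (complex_algebra_1, complex_algebra_1) complex_algebra_1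
begin

definition one_tensor :: "('a, 'b) tensor" where "one_tensor = 1 \<otimes> 1"

definition times_tensor :: "('a, 'b) tensor \<Rightarrow> ('a, 'b) tensor \<Rightarrow> ('a, 'b) tensor"
  where "S * T = tensor_lift (\<lambda>x y. tensor_lift (\<lambda>x' y'. (x * x') \<otimes> (y * y')) T) S"

lemma inner_bilinear: "complex_bilinear (\<lambda>x' y'. (x * x') \<otimes> (y * y' :: 'b))" for x :: 'a
  by (rule complex_bilinearI) (simp_all add: distrib_left complex_bilinearD[OF tensor_bilinear])

lemma inner_bilinear': "complex_bilinear (\<lambda>x y. (x * x') \<otimes> (y * y' :: 'b))" for x' :: 'a
  by (rule complex_bilinearI) (simp_all add: distrib_right complex_bilinearD[OF tensor_bilinear])

lemma outer_bilinear:
  "complex_bilinear (\<lambda>x y. tensor_lift (\<lambda>x' y'. (x * x') \<otimes> (y * y')) T)" for T :: "('a, 'b) tensor"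
  by (rule complex_bilinearI)
    (simp_all add: distrib_right complex_bilinearD[OF tensor_bilinear] tensor_lift_linear_in_map)

lemma tensor_mult_simps:
  fixes S T U :: "('a, 'b) tensor"
  shows "(x \<otimes> y) * (x' \<otimes> y') = (x * x') \<otimes> (y * y' :: 'b)"
    and "(S + T) * U = S * U + T * U" "U * (S + T) = U * S + U * T"
    and "(c *\<^sub>C S) * T = c *\<^sub>C (S * T)" "S * (c *\<^sub>C T) = c *\<^sub>C (S * T)"
  by (simp_all add: times_tensor_def tensor_lift_tensor[OF outer_bilinear] tensor_lift_tensor[OF inner_bilinear]
      tensor_lift_tensor[OF inner_bilinear']
      tensor_lift_add[OF outer_bilinear] tensor_lift_add[OF inner_bilinear]
      tensor_lift_scaleC[OF outer_bilinear] tensor_lift_scaleC[OF inner_bilinear] tensor_lift_linear_in_map)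

instance
proof
  fix S T U :: "('a, 'b) tensor" and c :: complex
  show "S * T * U = S * (T * U)"
  proof (induction S rule: tensor_induct)
    case (tensor x y)
    show ?case
    proof (induction T rule: tensor_induct)
      case (tensor x' y')
      show ?case
        by (induction U rule: tensor_induct) (simp_all add: tensor_mult_simps mult.assoc)
    qed (simp add: tensor_mult_simps)
  qed (simp add: tensor_mult_simps)
  show "1 * S = S" "S * 1 = S"
    by (induction S rule: tensor_induct; simp add: tensor_mult_simps one_tensor_def distrib_left distrib_right)+
  show "(0 :: ('a, 'b) tensor) \<noteq> 1"
  proof
    assume eq: "(0 :: ('a, 'b) tensor) = 1"
    obtain \<phi> :: "'a \<Rightarrow> complex" where \<phi>: "\<And>x y. \<phi> (x + y) = \<phi> x + \<phi> y" "\<And>c x. \<phi> (c *\<^sub>C x) = c * \<phi> x" "\<phi> 1 = 1"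
      by (rule complex_linear_functional_one) blast
    obtain \<psi> :: "'b \<Rightarrow> complex" where \<psi>: "\<And>x y. \<psi> (x + y) = \<psi> x + \<psi> y" "\<And>c x. \<psi> (c *\<^sub>C x) = c * \<psi> x" "\<psi> 1 = 1"
      by (rule complex_linear_functional_one) blast
    have B: "complex_bilinear (\<lambda>x y. \<phi> x * \<psi> y)"
      by (rule complex_bilinearI) (simp_all add: \<phi> \<psi> algebra_simps scaleC_complex_def)
    have "tensor_lift (\<lambda>x y. \<phi> x * \<psi> y) (1 :: ('a, 'b) tensor) = 1"
      by (simp add: one_tensor_def tensor_lift_tensor[OF B] \<phi> \<psi>)
    then show False by (simp add: eq[symmetric] tensor_lift_zero[OF B])
  qed
qed (simp_all add: tensor_mult_simps)

end


text \<open>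
  For a type \<open>'a\<close> of coefficients, \<open>'a fps\<close> is the space of formal power series in the deformation
  parameter \<open>\<lambda>\<close> with coefficients in \<open>'a\<close>.  Linear and bilinear maps are extended to power series
  coefficientwise and by the Cauchy product, respectively.
\<close>

definition fps_map_coeffs :: "('a \<Rightarrow> 'b) \<Rightarrow> 'a fps \<Rightarrow> 'b fps"
  where "fps_map_coeffs h x = Abs_fps (\<lambda>n. h (fps_nth x n))"

definition fps_cauchy :: "('a \<Rightarrow> 'b \<Rightarrow> 'c::comm_monoid_add) \<Rightarrow> 'a fps \<Rightarrow> 'b fps \<Rightarrow> 'c fps"
  where "fps_cauchy B x y = Abs_fps (\<lambda>n. \<Sum>k\<le>n. B (fps_nth x k) (fps_nth y (n - k)))"

abbreviation fps_scaleC :: "complex fps \<Rightarrow> 'v::complex_vector fps \<Rightarrow> 'v fps"  (infixr "\<cdot>\<^sub>\<lambda>" 75)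
  where "c \<cdot>\<^sub>\<lambda> x \<equiv> fps_cauchy scaleC c x"

abbreviation fps_tensor ::
    "'a::complex_vector fps \<Rightarrow> 'b::complex_vector fps \<Rightarrow> ('a, 'b) tensor fps"  (infixr "\<otimes>\<^sub>\<lambda>" 75)
  where "x \<otimes>\<^sub>\<lambda> y \<equiv> fps_cauchy tensor x y"

text \<open>
  \<open>fps_contract B G\<close> is the element written \<open>B(g\<^sup>\<alpha>, g\<^sub>\<alpha>)\<close>, summed over \<open>\<alpha>\<close>, for \<open>G = g\<^sup>\<alpha> \<otimes> g\<^sub>\<alpha>\<close> and a
  complex bilinear map \<open>B\<close> whose values are themselves power series in \<open>\<lambda>\<close>.  It does not depend on
  the decomposition of \<open>G\<close>.
\<close>

definition fps_contract ::
    "('a::complex_vector \<Rightarrow> 'b::complex_vector \<Rightarrow> 'v::complex_vector fps) \<Rightarrow> ('a, 'b) tensor fps \<Rightarrow> 'v fps"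
  where "fps_contract B G =
    Abs_fps (\<lambda>n. \<Sum>k\<le>n. tensor_lift (\<lambda>x y. fps_nth (B x y) (n - k)) (fps_nth G k))"

definition ring_inverse :: "'a::ring_1 \<Rightarrow> 'a"
  where "ring_inverse x = (THE y. x * y = 1 \<and> y * x = 1)"

type_synonym 'l twist = "('l uea, 'l uea) tensor fps"

definition twist_flip :: "'l::complex_lie_algebra twist \<Rightarrow> 'l twist"
  where "twist_flip F = fps_map_coeffs (tensor_lift (\<lambda>x y. y \<otimes> x)) F"

definition R_matrix :: "'l::complex_lie_algebra twist \<Rightarrow> 'l twist"
  where "R_matrix F = twist_flip F * ring_inverse F"

definition twist_chi :: "'l::complex_lie_algebra twist \<Rightarrow> 'l uea fps"
  where "twist_chi F = fps_contract (\<lambda>x y. fps_const (x * antipode y)) F"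

definition twist_X :: "'l::complex_lie_algebra twist \<Rightarrow> 'l uea \<Rightarrow> 'l uea fps"
  where "twist_X F \<xi> =
    fps_contract (\<lambda>x y. fps_const (x * \<xi>) * twist_chi F * fps_const (inv antipode y)) (ring_inverse F)"

definition star_lie ::
    "'l::complex_lie_algebra twist \<Rightarrow> 'l fps \<Rightarrow> 'l fps \<Rightarrow> 'l fps"
  where "star_lie F u v =
    fps_contract (\<lambda>x y. fps_cauchy lie (fps_map_coeffs (uea_act x) u) (fps_map_coeffs (uea_act y) v))
      (ring_inverse F)"

definition star_coproduct ::
    "'l::complex_lie_algebra twist \<Rightarrow> 'l fps \<Rightarrow> ('l uea, 'l uea) tensor fps"
  where "star_coproduct F u =
    fps_map_coeffs uea_of u \<otimes>\<^sub>\<lambda> 1 +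
    fps_contract (\<lambda>x y. twist_X F x \<otimes>\<^sub>\<lambda> fps_map_coeffs uea_of (fps_map_coeffs (uea_act y) u))
      (ring_inverse (R_matrix F))"

text \<open>
  The constant matrix \<open>\<theta>\<close>, block diagonal with blocks \<open>(0, 1; -1, 0)\<close>; indices start at \<open>0\<close>, so the
  \<open>k\<close>-th block occupies the indices \<open>2k\<close> and \<open>2k + 1\<close>.
\<close>

definition theta :: "nat \<Rightarrow> nat \<Rightarrow> complex"
  where "theta a b =
    (if even a \<and> b = Suc a then 1 else if even b \<and> a = Suc b then -1 else 0)"

text \<open>
  \<open>exp_lambda T\<close> is \<open>exp(\<lambda> T)\<close>, and \<open>RJS_twist n V\<close> is the twist built from the \<open>2n\<close> elements
  \<open>V 0, ..., V (2n - 1)\<close>.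
\<close>

definition exp_lambda :: "'a::complex_algebra_1 \<Rightarrow> 'a fps"
  where "exp_lambda T = Abs_fps (\<lambda>k. (1 / fact k) *\<^sub>C T ^ k)"

definition RJS_twist :: "nat \<Rightarrow> (nat \<Rightarrow> 'l::complex_lie_algebra) \<Rightarrow> 'l twist"
  where "RJS_twist n V =
    exp_lambda ((- \<i> / 2) *\<^sub>C (\<Sum>a<2*n. \<Sum>b<2*n. theta a b *\<^sub>C (uea_of (V a) \<otimes> uea_of (V b))))"

definition deformed_generators :: "nat \<Rightarrow> (nat \<Rightarrow> 'l) \<Rightarrow> (nat \<Rightarrow> 'l fps) \<Rightarrow> bool"
  where "deformed_generators d t ts \<longleftrightarrow> (\<forall>i<d. fps_nth (ts i) 0 = t i)"

definition lambda_span :: "nat \<Rightarrow> (nat \<Rightarrow> 'l::complex_vector fps) \<Rightarrow> 'l fps set"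
  where "lambda_span d ts = {\<Sum>i<d. c i \<cdot>\<^sub>\<lambda> ts i |c. True}"

definition star_closed ::
    "'l::complex_lie_algebra twist \<Rightarrow> nat \<Rightarrow> (nat \<Rightarrow> nat \<Rightarrow> nat \<Rightarrow> complex) \<Rightarrow> (nat \<Rightarrow> 'l fps) \<Rightarrow> bool"
  where "star_closed F d f ts \<longleftrightarrow>
    (\<exists>fs :: nat \<Rightarrow> nat \<Rightarrow> nat \<Rightarrow> complex fps.
      (\<forall>i<d. \<forall>j<d. star_lie F (ts i) (ts j) = (\<Sum>k<d. fs i j k \<cdot>\<^sub>\<lambda> ts k)) \<and>
      (\<forall>i<d. \<forall>j<d. \<forall>k<d. fps_nth (fs i j k) 0 = f i j k))"

text \<open>
  The subspace \<open>\<gg>\<^sub>\<star> \<otimes> 1 + U\<Xi>\<^sub>\<star> \<otimes> \<gg>\<^sub>\<star>\<close> for a subspace \<open>\<gg>\<^sub>\<star>\<close> of \<open>\<Xi>\<^sub>\<star>\<close>; as a vector space,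
  \<open>U\<Xi>\<^sub>\<star>\<close> is the space of power series over \<open>U\<Xi>\<close>.
\<close>

definition coproduct_target :: "'l::complex_lie_algebra fps set \<Rightarrow> ('l uea, 'l uea) tensor fps set"
  where "coproduct_target G =
    {fps_map_coeffs uea_of w \<otimes>\<^sub>\<lambda> 1 + (\<Sum>i<m. \<xi> i \<otimes>\<^sub>\<lambda> fps_map_coeffs uea_of (v i)) |w m \<xi> v.
       w \<in> G \<and> (\<forall>i<(m::nat). v i \<in> G)}"

definition star_coideal :: "'l::complex_lie_algebra twist \<Rightarrow> 'l fps set \<Rightarrow> bool"
  where "star_coideal F G \<longleftrightarrow> star_coproduct F ` G \<subseteq> coproduct_target G"

text \<open>
  A decomposition \<open>G = g\<^sup>\<alpha> \<otimes> g\<^sub>\<alpha>\<close> in which linearly dependent summands have been combined.  The index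
  \<open>\<alpha>\<close> is a pair \<open>(k, j)\<close> with \<open>j < N k\<close>, where \<open>k\<close> is the order in \<open>\<lambda>\<close>: the summand
  is \<open>\<lambda>\<^sup>k p k j \<otimes> q k j\<close>, the power of \<open>\<lambda>\<close> belonging to the first leg.
\<close>

definition leg_decomposition ::
    "('a::complex_vector, 'b::complex_vector) tensor fps \<Rightarrow>
      (nat \<Rightarrow> nat) \<Rightarrow> (nat \<Rightarrow> nat \<Rightarrow> 'a) \<Rightarrow> (nat \<Rightarrow> nat \<Rightarrow> 'b) \<Rightarrow> bool"
  where "leg_decomposition G N p q \<longleftrightarrow>
    (\<forall>k. fps_nth G k = (\<Sum>j<N k. p k j \<otimes> q k j) \<and>
         inj_on (p k) {..<N k} \<and> complex_vector.independent (p k ` {..<N k}))"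

definition second_legs_preserve ::
    "(nat \<Rightarrow> nat) \<Rightarrow> (nat \<Rightarrow> nat \<Rightarrow> 'l::complex_lie_algebra uea) \<Rightarrow> 'l fps set \<Rightarrow> bool"
  where "second_legs_preserve N q G \<longleftrightarrow>
    (\<forall>k. \<forall>j<N k. \<forall>u\<in>G. fps_map_coeffs (uea_act (q k j)) u \<in> G)"

definition lie_subalgebra :: "'l::complex_lie_algebra set \<Rightarrow> bool"
  where "lie_subalgebra S \<longleftrightarrow>
    complex_vector.subspace S \<and> (\<forall>x\<in>S. \<forall>y\<in>S. lie x y \<in> S)"

definition lie_ideal :: "'l::complex_lie_algebra set \<Rightarrow> 'l set \<Rightarrow> bool"
  where "lie_ideal I S \<longleftrightarrow>
    complex_vector.subspace I \<and> I \<subseteq> S \<and> (\<forall>x\<in>S. \<forall>y\<in>I. lie x y \<in> I)"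

end

theory Submission
  imports Defs
begin

text \<open>
  The inverse R-matrix is \<open>exp(- \<i> \<lambda> \<Theta>)\<close> with \<open>\<Theta> = \<theta>\<^sup>a\<^sup>b V\<^sub>a \<otimes> V\<^sub>b\<close>, so all its second legs are polynomials in
  the \<open>V\<^sub>b\<close>, and everything reduces to showing that the coideal property makes each \<open>V\<^sub>b\<close> preserve
  \<open>\<gg>\<^sub>\<star>\<close>.

  Contract the first leg of \<open>\<Delta>\<^sub>\<star>(u)\<close> with a linear functional on \<open>U\<Xi>\<close> that vanishes on \<open>1\<close> and is dual
  to the partner of \<open>V\<^sub>b\<close> in its block of \<open>\<theta>\<close>, and the second leg with a linear left inverse of
  \<open>\<Xi> \<rightarrow> U\<Xi>\<close> that vanishes on \<open>1\<close>.  This gives an operator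
  \<open>\<lambda> (c + e V\<^sub>b) + \<lambda>\<^sup>2 z\<^sub>2(V) + \<lambda>\<^sup>3 z\<^sub>3(V) + \<dots>\<close> with \<open>e \<noteq> 0\<close> and polynomials \<open>z\<^sub>l\<close>
  that preserves \<open>\<gg>\<^sub>\<star>\<close>, and \<open>\<lambda>\<close> can be divided out.  If all \<open>V\<^sub>a\<close> preserve \<open>\<gg>\<^sub>\<star>\<close> modulo \<open>\<lambda>\<^sup>n\<close>, so do the
  \<open>z\<^sub>l(V)\<close>; since these carry an additional factor \<open>\<lambda>\<close>, each \<open>V\<^sub>b\<close> preserves \<open>\<gg>\<^sub>\<star>\<close> modulo
  \<open>\<lambda>\<^sup>n\<^sup>+\<^sup>1\<close>.  As \<open>\<gg>\<^sub>\<star>\<close> is \<open>\<lambda>\<close>-adically closed, it is preserved by \<open>V\<^sub>b\<close>, and the order zero in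
  \<open>\<lambda>\<close> is the claim about \<open>\<gg>\<close>.  The Poincare-Birkhoff-Witt theorem is not needed, only the injectivity of
  \<open>\<Xi> \<rightarrow> U\<Xi>\<close>, which holds because the centre of \<open>\<Xi>\<close> is trivial.
\<close>

subsection \<open>Linear maps, tensors and power series\<close>

abbreviation clinear :: "('a::complex_vector \<Rightarrow> 'b::complex_vector) \<Rightarrow> bool"
  where "clinear \<equiv> Vector_Spaces.linear scaleC scaleC"

global_interpretation complex_vector_pair: vector_space_pair
  "scaleC :: complex \<Rightarrow> 'a \<Rightarrow> 'a::complex_vector" "scaleC :: complex \<Rightarrow> 'b \<Rightarrow> 'b::complex_vector"
  by unfold_locales

lemma clinearI:
  assumes "\<And>x y. h (x + y) = h x + h y" "\<And>c x. h (c *\<^sub>C x) = c *\<^sub>C h x"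
  shows "clinear h"
  by unfold_locales (simp_all add: assms)

lemma clinear_simps:
  assumes "clinear h"
  shows "h (x + y) = h x + h y" "h (c *\<^sub>C x) = c *\<^sub>C h x" "h 0 = 0"
    and "h (- x) = - h x" "h (x - y) = h x - h y"
    and "h (sum g A) = (\<Sum>a\<in>A. h (g a))"
  using complex_vector_pair.linear_add[OF assms] complex_vector_pair.linear_scale[OF assms]
    complex_vector_pair.linear_0[OF assms]
    complex_vector_pair.linear_neg[OF assms] complex_vector_pair.linear_diff[OF assms]
    complex_vector_pair.linear_sum[OF assms] by blast+

lemma clinear_tensor_lift:
  "complex_bilinear B \<Longrightarrow> clinear (tensor_lift B)"
  by (rule clinearI) (simp_all add: tensor_lift_add tensor_lift_scaleC)

lemma tensor_lift_sum_map: "tensor_lift (\<lambda>x y. \<Sum>i\<in>I. B i x y) T = (\<Sum>i\<in>I. tensor_lift (B i) T)"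
proof (cases "finite I")
  case True
  then show ?thesis
  proof induction
    case empty
    show ?case using tensor_lift_linear_in_map(2)[of 0 "\<lambda>x y. 0" T] by simp
  qed (simp add: tensor_lift_linear_in_map)
next
  case False
  then show ?thesis using tensor_lift_linear_in_map(2)[of 0 "\<lambda>x y. 0" T] by simp
qed

lemma clinear_compose_tensor_lift:
  assumes h: "clinear h" and B: "complex_bilinear B"
  shows "h (tensor_lift B T) = tensor_lift (\<lambda>x y. h (B x y)) T"
proof -
  have "complex_bilinear (\<lambda>x y. h (B x y))"
    by (rule complex_bilinearI) (simp_all add: clinear_simps[OF h] complex_bilinearD[OF B])
  then show ?thesis
    by (induction T rule: tensor_induct)
      (simp_all add: tensor_lift_tensor tensor_lift_add B clinear_simps[OF h])
qed

lemma complex_bilinear_clinear: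
  "clinear g \<Longrightarrow> clinear h \<Longrightarrow> complex_bilinear (\<lambda>x y. (g x :: complex) *\<^sub>C h y)"
  by (rule complex_bilinearI)
    (simp_all add: clinear_simps scaleC_left_distrib scaleC_right_distrib scaleC_complex_def mult.commute)

lemma fps_map_coeffs_nth [simp]: "fps_nth (fps_map_coeffs h x) n = h (fps_nth x n)"
  by (simp add: fps_map_coeffs_def)

lemma fps_cauchy_nth: "fps_nth (fps_cauchy B x y) n = (\<Sum>k\<le>n. B (fps_nth x k) (fps_nth y (n - k)))"
  by (simp add: fps_cauchy_def)

lemma fps_cauchy_sum_right:
  assumes "\<And>c. B c 0 = 0" "\<And>c x y. B c (x + y) = B c x + B c (y::'b::ab_group_add)"
  shows "fps_cauchy B c (\<Sum>i\<in>I. x i) = (\<Sum>i\<in>I. fps_cauchy B c (x i))"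
proof -
  have "B c (sum f I) = (\<Sum>i\<in>I. B c (f i))" for c f
    by (induction I rule: infinite_finite_induct) (simp_all add: assms)
  then show ?thesis
    by (intro fps_ext) (simp add: fps_cauchy_nth fps_sum_nth sum.swap[of _ I])
qed

subsection \<open>Exponentials and the universal R-matrix\<close>

lemma power_scaleC: "(c *\<^sub>C T) ^ k = c ^ k *\<^sub>C (T::'a::complex_algebra_1) ^ k"
  by (induction k) (simp_all add: mult.commute)

lemma exp_lambda_zero [simp]: "exp_lambda (0::'a::complex_algebra_1) = 1"
  by (rule fps_ext) (auto simp: exp_lambda_def power_0_left)

text \<open>Both exponents are multiples of the same \<open>T\<close>, so no commutators arise and
  each order in \<lambda> is the binomial theorem for \<open>c\<close> and \<open>d\<close>.\<close>

lemma exp_lambda_mult: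
  "exp_lambda (c *\<^sub>C T) * exp_lambda (d *\<^sub>C T) = exp_lambda ((c + d) *\<^sub>C (T::'a::complex_algebra_1))"
proof (rule fps_ext)
  fix n
  have "fps_nth (exp_lambda (c *\<^sub>C T) * exp_lambda (d *\<^sub>C T)) n =
      (\<Sum>i=0..n. (1 / fact i * c ^ i * (1 / fact (n - i) * d ^ (n - i))) *\<^sub>C T ^ n)"
    unfolding fps_mult_nth
  proof (rule sum.cong)
    fix i assume "i \<in> {0..n}"
    then have "T ^ i * T ^ (n - i) = T ^ n" by (simp flip: power_add)
    then show "fps_nth (exp_lambda (c *\<^sub>C T)) i * fps_nth (exp_lambda (d *\<^sub>C T)) (n - i) =
      (1 / fact i * c ^ i * (1 / fact (n - i) * d ^ (n - i))) *\<^sub>C T ^ n"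
      by (simp add: exp_lambda_def power_scaleC mult_ac)
  qed simp
  also have "\<dots> = (\<Sum>i\<le>n. 1 / fact n * (of_nat (n choose i) * c ^ i * d ^ (n - i))) *\<^sub>C T ^ n"
    unfolding complex_vector.scale_sum_left
    by (intro sum.cong arg_cong2[where f=scaleC]) (auto simp: binomial_fact)
  also have "\<dots> = (1 / fact n * (c + d) ^ n) *\<^sub>C T ^ n"
    by (simp add: binomial_ring sum_distrib_left)
  also have "\<dots> = fps_nth (exp_lambda ((c + d) *\<^sub>C T)) n"
    by (simp add: exp_lambda_def power_scaleC)
  finally show "fps_nth (exp_lambda (c *\<^sub>C T) * exp_lambda (d *\<^sub>C T)) n =
    fps_nth (exp_lambda ((c + d) *\<^sub>C T)) n" .
qed

lemma ring_inverse_eqI: "x * y = 1 \<Longrightarrow> y * x = 1 \<Longrightarrow> ring_inverse x = y"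
  unfolding ring_inverse_def by (rule the_equality) (auto, metis mult.assoc mult_1)

lemma ring_inverse_exp_lambda:
  "ring_inverse (exp_lambda (c *\<^sub>C T)) = exp_lambda (- c *\<^sub>C (T::'a::complex_algebra_1))"
  by (rule ring_inverse_eqI) (simp_all only: exp_lambda_mult, simp_all)

definition tensor_flip :: "('a::complex_vector, 'b::complex_vector) tensor \<Rightarrow> ('b, 'a) tensor"
  where "tensor_flip = tensor_lift (\<lambda>x y. y \<otimes> x)"

lemma bilinear_flip: "complex_bilinear (\<lambda>x y. y \<otimes> x)"
  by (rule complex_bilinearI) (simp_all add: complex_bilinearD[OF tensor_bilinear])

lemma tensor_flip_tensor [simp]: "tensor_flip (x \<otimes> y) = y \<otimes> x"
  by (simp add: tensor_flip_def tensor_lift_tensor bilinear_flip)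

lemma clinear_tensor_flip: "clinear tensor_flip"
  unfolding tensor_flip_def by (intro clinear_tensor_lift bilinear_flip)

lemmas tensor_flip_simps [simp] = clinear_simps[OF clinear_tensor_flip]

lemma tensor_flip_mult:
  "tensor_flip (S * T) = tensor_flip S * tensor_flip (T::('a::complex_algebra_1, 'b::complex_algebra_1) tensor)"
proof (induction S rule: tensor_induct)
  case (tensor x y)
  show ?case
    by (induction T rule: tensor_induct) (simp_all add: tensor_mult_simps)
qed (simp add: tensor_mult_simps)

lemma tensor_flip_power:
  "tensor_flip (T ^ k) = tensor_flip (T::('a::complex_algebra_1, 'b::complex_algebra_1) tensor) ^ k"
  by (induction k) (simp_all add: tensor_flip_mult one_tensor_def)

definition theta_tensor :: "nat \<Rightarrow> (nat \<Rightarrow> 'l::complex_lie_algebra) \<Rightarrow> ('l uea, 'l uea) tensor"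
  where "theta_tensor n V = (\<Sum>a<2*n. \<Sum>b<2*n. theta a b *\<^sub>C (uea_of (V a) \<otimes> uea_of (V b)))"

lemma RJS_twist_eq: "RJS_twist n V = exp_lambda ((- \<i> / 2) *\<^sub>C theta_tensor n V)"
  by (simp add: RJS_twist_def theta_tensor_def)

lemma theta_antisym: "theta b a = - theta a b"
  by (auto simp: theta_def)

lemma tensor_flip_theta: "tensor_flip (theta_tensor n V) = - theta_tensor n V"
proof -
  have "tensor_flip (theta_tensor n V) = (\<Sum>a<2*n. \<Sum>b<2*n. theta b a *\<^sub>C (uea_of (V a) \<otimes> uea_of (V b)))"
    unfolding theta_tensor_def by (simp, rule sum.swap)
  also have "\<dots> = - theta_tensor n V"
    unfolding theta_tensor_def sum_negf[symmetric] complex_vector.scale_minus_left[symmetric]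
    by (intro sum.cong refl arg_cong2[where f=scaleC] theta_antisym)
  finally show ?thesis .
qed

lemma ring_inverse_RJS_twist: "ring_inverse (RJS_twist n V) = exp_lambda ((\<i> / 2) *\<^sub>C theta_tensor n V)"
  unfolding RJS_twist_eq ring_inverse_exp_lambda by simp

text \<open>Antisymmetry of \<open>theta\<close> makes the flip negate the exponent, so the flipped
  twist is the inverse twist and the R-matrix is the square of the latter.\<close>

lemma R_matrix_RJS_twist: "R_matrix (RJS_twist n V) = exp_lambda (\<i> *\<^sub>C theta_tensor n V)"
proof -
  have "twist_flip (RJS_twist n V) = exp_lambda ((\<i> / 2) *\<^sub>C theta_tensor n V)"
    unfolding twist_flip_def tensor_flip_def[symmetric]
    by (intro fps_ext) (simp add: RJS_twist_eq exp_lambda_def tensor_flip_power tensor_flip_theta)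
  then show ?thesis
    by (simp add: R_matrix_def ring_inverse_RJS_twist exp_lambda_mult)
qed

lemma inverse_R_matrix_RJS_twist:
  "ring_inverse (R_matrix (RJS_twist n V)) = exp_lambda (- \<i> *\<^sub>C theta_tensor n V)"
  by (simp add: R_matrix_RJS_twist ring_inverse_exp_lambda)

subsection \<open>Enveloping algebra\<close>

lemma clinear_uea_of: "clinear uea_of"
proof -
  have 0: "uea_of (0::'a) = 0"
    using uea_of_linear[of "-1" "0::'a" 0] by simp
  show ?thesis
    using uea_of_linear[of 1] uea_of_linear[of _ _ "0::'a"]
    by (intro clinearI) (simp_all add: 0)
qed

lemma clinear_uea_act: "clinear (uea_act x)" "clinear (\<lambda>x. uea_act x u)"
  by (rule clinearI; simp add: uea_act_linear)+

text \<open>Reversing a word twice restores it and the two signs cancel. The antipode is thus its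
  own inverse, which identifies the \<open>inv antipode\<close> in \<open>twist_X\<close>.\<close>

lemma free_antipode_free_antipode: "free_antipode (free_antipode y) = y"
proof -
  have sq: "(-1) ^ k * (-1) ^ k = (1::complex)" for k :: nat
    by (simp flip: power_mult_distrib)
  show ?thesis
  proof (induction y rule: poly_mapping_single_induct)
    case (single k c)
    show ?case by (simp add: single_scaleC[symmetric] mult.assoc sq)
  qed (simp_all add: linear_extension_simps)
qed

lemma antipode_antipode: "antipode (antipode x) = x"
  by transfer (simp add: uea_rel_def uea_ideal_zero free_antipode_free_antipode)

lemma clinear_antipode: "clinear antipode"
  by (rule clinearI; transfer; simp add: linear_extension_simps uea_rel_def uea_ideal_zero)

lemma inv_antipode: "inv antipode = antipode"
  by (rule inv_unique_comp) (auto simp: fun_eq_iff antipode_antipode)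

lift_definition uea_counit :: "'l::complex_lie_algebra uea \<Rightarrow> complex"
  is "linear_extension (\<lambda>w. if letters w = [] then 1 else 0)"
  subgoal for x y
    using uea_empty_word_coeff[of "x - y"] by (simp add: uea_rel_def linear_extension_diff)
  done

lemma clinear_uea_counit: "clinear uea_counit"
  by (rule clinearI; transfer; simp add: linear_extension_simps)

lemma uea_counit_one: "uea_counit 1 = 1"
  by transfer (simp add: single_one[symmetric] del: single_one)

lemma uea_counit_uea_of: "uea_counit (uea_of u) = 0"
  by transfer simp

text \<open>An injective linear map has a linear left inverse \<open>g\<close>. Subtracting the
  counit part before applying \<open>g\<close> forces the value \<open>0\<close> at \<open>1\<close>
  and changes nothing on \<open>uea_of u\<close>, where the counit vanishes.\<close>

lemma uea_projection:
  assumes "inj (uea_of :: 'l \<Rightarrow> 'l::complex_lie_algebra uea)"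
  obtains \<psi> :: "'l uea \<Rightarrow> 'l::complex_lie_algebra"
  where "clinear \<psi>" "\<psi> 1 = 0" "\<And>u. \<psi> (uea_of u) = u"
proof -
  obtain g :: "'l uea \<Rightarrow> 'l" where g: "clinear g" "g \<circ> uea_of = id"
    using complex_vector_pair.linear_injective_left_inverse[OF clinear_uea_of assms] by blast
  define \<psi> where "\<psi> x = g (x - uea_counit x *\<^sub>C 1)" for x
  show thesis
  proof
    show "clinear \<psi>"
      by (rule clinearI)
        (simp_all add: \<psi>_def clinear_simps[OF g(1)] clinear_simps[OF clinear_uea_counit]
          scaleC_left_distrib scaleC_complex_def complex_vector.scale_right_diff_distrib)
    show "\<psi> 1 = 0"
      by (simp add: \<psi>_def uea_counit_one clinear_simps[OF g(1)])
    show "\<psi> (uea_of u) = u" for u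
      using g(2) by (simp add: \<psi>_def uea_counit_uea_of fun_eq_iff)
  qed
qed

text \<open>
  A central derivation \<open>D\<close> commutes with \<open>f D\<close>, and evaluating this commutator at \<open>f\<close> gives
  \<open>(D f)\<^sup>2 = 0\<close>.
\<close>

lemma vector_field_center_trivial:
  fixes D :: "'m::smooth_manifold vector_field"
  assumes "\<And>E. lie D E = 0"
  shows "D = 0"
proof -
  have D: "derivation (lie_derivative D)" using lie_derivative by blast
  have "lie_derivative D f x = 0" for f x
  proof (cases "smooth_fun f")
    case True
    have fD: "derivation (\<lambda>g x. f x * lie_derivative D g x)"
    proof (rule derivationI, goal_cases)
      case (1 g)
      then show ?case by (simp add: derivationD(1)[OF D])
    next
      case (2 g)
      then show ?case by (intro smooth_fun_mult True derivationD(2)[OF D])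
    qed (simp_all only: derivationD[OF D], simp_all add: algebra_simps)
    define E where "E = Abs_vector_field (\<lambda>g x. f x * lie_derivative D g x)"
    have E: "lie_derivative E = (\<lambda>g x. f x * lie_derivative D g x)"
      using fD by (simp add: E_def Abs_vector_field_inverse)
    have "0 = lie_derivative (lie D E) f x" by (simp add: assms zero_vector_field.rep_eq)
    also have "\<dots> = lie_derivative D f x * lie_derivative D f x"
      using derivationD(5)[OF D True derivationD(2)[OF D True]]
      by (simp add: lie_vector_field.rep_eq E)
    finally show ?thesis by simp
  qed (rule derivationD(1)[OF D])
  then show ?thesis
    by (simp add: fun_eq_iff zero_vector_field.rep_eq flip: lie_derivative_inject)
qed

text \<open>The action on vector fields recovers \<open>lie D X\<close> from
  \<open>uea_of D\<close>, so fields with the same image differ by a central one.\<close>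

lemma inj_uea_of_vector_field: "inj (uea_of :: 'm::smooth_manifold vector_field \<Rightarrow> _)"
proof (rule injI)
  fix D E :: "'m vector_field" assume eq: "uea_of D = uea_of E"
  have "lie (D - E) X = 0" for X
  proof -
    have "lie D X = lie E X" using arg_cong[OF eq, of "\<lambda>x. uea_act x X"] by (simp add: uea_act_uea_of)
    then show ?thesis using lie_add_left[of "D - E" E X] by simp
  qed
  from vector_field_center_trivial[OF this] show "D = E" by simp
qed

subsection \<open>Contraction of the first leg\<close>

definition unital_subalgebra :: "'a::complex_algebra_1 set \<Rightarrow> bool"
  where "unital_subalgebra P \<longleftrightarrow>
    complex_vector.subspace P \<and> 1 \<in> P \<and> (\<forall>x\<in>P. \<forall>y\<in>P. x * y \<in> P)"

text \<open>The subspace \<open>A \<otimes> P\<close> of the full tensor product, given as a span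
  because \<open>P\<close> is a set and not a type.\<close>

definition second_legs_in :: "'b set \<Rightarrow> ('a::complex_vector, 'b::complex_vector) tensor set"
  where "second_legs_in P = complex_vector.span {x \<otimes> y |x y. y \<in> P}"

lemma second_legs_in_power:
  fixes T :: "('a::complex_algebra_1, 'b::complex_algebra_1) tensor"
  assumes P: "unital_subalgebra P" and T: "T \<in> second_legs_in P"
  shows "T ^ k \<in> second_legs_in P"
proof (induction k)
  case 0
  show ?case
    using P unfolding second_legs_in_def unital_subalgebra_def
    by (auto simp: one_tensor_def intro!: complex_vector.span_base)
next
  case (Suc k)
  have m: "(x \<otimes> y) * S \<in> second_legs_in P" if y: "y \<in> P" and S: "S \<in> second_legs_in P"
    for x y and S :: "('a, 'b) tensor"
    using S unfolding second_legs_in_def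
  proof (induction rule: complex_vector.span_induct_alt)
    case base
    show ?case by (simp add: complex_vector.span_zero)
  next
    case (step c s S)
    then obtain x' y' where s: "s = x' \<otimes> y'" "y' \<in> P" by blast
    have "(x \<otimes> y) * s \<in> {x \<otimes> y |x y. y \<in> P}"
      using s y P by (auto simp: tensor_mult_simps unital_subalgebra_def)
    then show ?case using step(2)
      by (simp add: tensor_mult_simps complex_vector.span_add complex_vector.span_scale complex_vector.span_base)
  qed
  have "T * S \<in> second_legs_in P" if S: "S \<in> second_legs_in P" for S
    using T unfolding second_legs_in_def
  proof (induction rule: complex_vector.span_induct_alt)
    case base
    show ?case by (simp add: complex_vector.span_zero)
  next
    case (step c s U)
    then show ?case using m[OF _ S]
      by (auto simp: tensor_mult_simps second_legs_in_def
          intro!: complex_vector.span_add complex_vector.span_scale)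
  qed
  with Suc show ?case by simp
qed

text \<open>The map \<open>\<phi> \<otimes> id\<close>.\<close>

definition contract_first :: "('a::complex_vector \<Rightarrow> complex) \<Rightarrow> ('a, 'b::complex_vector) tensor \<Rightarrow> 'b"
  where "contract_first \<phi> = tensor_lift (\<lambda>x y. \<phi> x *\<^sub>C y)"

lemma bilinear_contract_first:
  "clinear \<phi> \<Longrightarrow> complex_bilinear (\<lambda>x y. (\<phi> x :: complex) *\<^sub>C y)"
  by (rule complex_bilinearI)
    (simp_all add: clinear_simps scaleC_left_distrib scaleC_right_distrib scaleC_complex_def mult.commute)

lemma contract_first_tensor: "clinear \<phi> \<Longrightarrow> contract_first \<phi> (x \<otimes> y) = \<phi> x *\<^sub>C y"
  by (simp add: contract_first_def tensor_lift_tensor bilinear_contract_first)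

lemma clinear_contract_first: "clinear \<phi> \<Longrightarrow> clinear (contract_first \<phi>)"
  unfolding contract_first_def by (intro clinear_tensor_lift bilinear_contract_first)

lemma contract_first_in:
  assumes P: "complex_vector.subspace P" and \<phi>: "clinear \<phi>" and T: "T \<in> second_legs_in P"
  shows "contract_first \<phi> T \<in> P"
  using T unfolding second_legs_in_def
proof (induction rule: complex_vector.span_induct_alt)
  case base
  show ?case using P by (simp add: clinear_simps[OF clinear_contract_first[OF \<phi>]] complex_vector.subspace_0)
next
  case (step c s U)
  then show ?case
    using P by (auto simp: clinear_simps[OF clinear_contract_first[OF \<phi>]] contract_first_tensor[OF \<phi>]
        intro!: complex_vector.subspace_add complex_vector.subspace_scale)
qed

lemma dual_functional:
  assumes "inj_on b I" "complex_vector.independent (b ` I)" "i \<in> I"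
  obtains \<phi> where "clinear \<phi>" "\<And>j. j \<in> I \<Longrightarrow> \<phi> (b j) = (if j = i then 1 else (0::complex))"
proof -
  obtain \<phi> where \<phi>: "clinear \<phi> \<and> (\<forall>x\<in>b ` I. \<phi> x = (if x = b i then 1 else (0::complex)))"
    using complex_vector_pair.linear_independent_extend[OF assms(2), of "\<lambda>x. if x = b i then 1 else (0::complex)"] ..
  show thesis
  proof
    show "clinear \<phi>" using \<phi> ..
    show "\<phi> (b j) = (if j = i then 1 else 0)" if "j \<in> I" for j
      using \<phi> that assms(1,3) by (simp add: inj_on_eq_iff)
  qed
qed

lemma theta_tensor_second_legs:
  assumes "complex_vector.subspace P" "\<And>b. b < 2*n \<Longrightarrow> uea_of (V b) \<in> P"
  shows "theta_tensor n V \<in> second_legs_in P"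
  unfolding theta_tensor_def second_legs_in_def
  by (intro complex_vector.span_sum complex_vector.span_scale complex_vector.span_base)
    (use assms(2) in auto)

lemma exp_theta_tensor_second_legs:
  assumes "unital_subalgebra P" "\<And>b. b < 2*n \<Longrightarrow> uea_of (V b) \<in> P"
  shows "fps_nth (exp_lambda (c *\<^sub>C theta_tensor n V)) k \<in> second_legs_in P"
proof -
  have "theta_tensor n V ^ k \<in> second_legs_in P"
    using assms by (intro second_legs_in_power theta_tensor_second_legs) (auto simp: unital_subalgebra_def)
  then show ?thesis
    by (simp add: exp_lambda_def power_scaleC second_legs_in_def complex_vector.span_scale)
qed

subsection \<open>The map X\<close>

text \<open>\<open>\<xi>\<close> enters the contracted map linearly, and \<open>tensor_lift\<close>,
  which evaluates on a fixed representative, is linear in the map.\<close>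

lemma clinear_twist_X: "clinear (\<lambda>\<xi>. fps_nth (twist_X F \<xi>) m)"
  by (rule clinearI)
    (simp_all add: twist_X_def fps_contract_def distrib_left distrib_right tensor_lift_linear_in_map
      sum.distrib complex_vector.scale_sum_right)

text \<open>At order zero the twist and its inverse are \<open>1 \<otimes> 1\<close>, so
  \<open>twist_chi\<close> starts with \<open>1\<close> and only \<open>\<xi>\<close>
  remains.\<close>

lemma twist_X_0:
  fixes F :: "'l::complex_lie_algebra twist"
  assumes "fps_nth F 0 = 1" "fps_nth (ring_inverse F) 0 = 1"
  shows "fps_nth (twist_X F \<xi>) 0 = \<xi>"
proof -
  have bil: "complex_bilinear (\<lambda>x y. x * a * antipode y)" for a :: "'l uea"
    by (rule complex_bilinearI) (simp_all add: clinear_simps[OF clinear_antipode] distrib_left distrib_right)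
  have "fps_nth (twist_chi F) 0 = 1"
    using tensor_lift_tensor[OF bil[of 1], of 1 1]
    by (simp add: twist_chi_def fps_contract_def assms one_tensor_def antipode_one)
  then show ?thesis
    using tensor_lift_tensor[OF bil[of \<xi>], of 1 1]
    by (simp add: twist_X_def fps_contract_def assms one_tensor_def antipode_one inv_antipode)
qed

subsection \<open>Modules of power series\<close>

definition lambda_module :: "'l::complex_vector fps set \<Rightarrow> bool"
  where "lambda_module G \<longleftrightarrow> 0 \<in> G \<and> (\<forall>u\<in>G. \<forall>v\<in>G. u + v \<in> G) \<and> (\<forall>c. \<forall>u\<in>G. c \<cdot>\<^sub>\<lambda> u \<in> G)"

text \<open>This is \<open>G + \<lambda>\<^sup>n \<Xi>[[\<lambda>]]\<close>, the elements that lie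
  in \<open>G\<close> modulo \<open>\<lambda>\<^sup>n\<close>.\<close>

definition agree_mod :: "nat \<Rightarrow> 'l::complex_vector fps set \<Rightarrow> 'l fps set"
  where "agree_mod n G = {v. \<exists>g\<in>G. \<forall>i<n. fps_nth v i = fps_nth g i}"

text \<open>The stabiliser of \<open>G\<close> in the undeformed enveloping algebra, whose elements
  act coefficientwise.\<close>

definition preserver :: "'l::complex_lie_algebra fps set \<Rightarrow> 'l uea set"
  where "preserver G = {y. \<forall>u\<in>G. fps_map_coeffs (uea_act y) u \<in> G}"

text \<open>The same rearrangement of a triangular double sum as for associativity of the Cauchy
  product.\<close>

lemma fps_scaleC_assoc: "c \<cdot>\<^sub>\<lambda> d \<cdot>\<^sub>\<lambda> v = (c * d) \<cdot>\<^sub>\<lambda> v"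
proof (rule fps_ext)
  fix n
  have "fps_nth (c \<cdot>\<^sub>\<lambda> d \<cdot>\<^sub>\<lambda> v) n =
      (\<Sum>k=0..n. \<Sum>l=0..n-k. (fps_nth c k * fps_nth d l) *\<^sub>C fps_nth v (n - k - l))"
    by (simp add: fps_cauchy_nth complex_vector.scale_sum_right atMost_atLeast0)
  also have "\<dots> = (\<Sum>k=0..n. \<Sum>l=0..k. (fps_nth c l * fps_nth d (k - l)) *\<^sub>C fps_nth v (n - k))"
    by (rule fps_mult_assoc_lemma[symmetric])
  also have "\<dots> = fps_nth ((c * d) \<cdot>\<^sub>\<lambda> v) n"
    by (simp add: fps_cauchy_nth fps_mult_nth complex_vector.scale_sum_left atMost_atLeast0)
  finally show "fps_nth (c \<cdot>\<^sub>\<lambda> d \<cdot>\<^sub>\<lambda> v) n = fps_nth ((c * d) \<cdot>\<^sub>\<lambda> v) n" .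
qed

lemma fps_scaleC_add: "(c + d) \<cdot>\<^sub>\<lambda> v = c \<cdot>\<^sub>\<lambda> v + d \<cdot>\<^sub>\<lambda> v" "c \<cdot>\<^sub>\<lambda> (u + v) = c \<cdot>\<^sub>\<lambda> u + c \<cdot>\<^sub>\<lambda> v"
  by (rule fps_ext; simp add: fps_cauchy_nth scaleC_left_distrib scaleC_right_distrib sum.distrib)+

lemma fps_scaleC_sum: "c \<cdot>\<^sub>\<lambda> (\<Sum>i\<in>I. v i) = (\<Sum>i\<in>I. c \<cdot>\<^sub>\<lambda> v i)"
  by (rule fps_cauchy_sum_right) (simp_all add: scaleC_right_distrib)

lemma fps_scaleC_const_nth: "fps_nth (fps_const c \<cdot>\<^sub>\<lambda> v) n = c *\<^sub>C fps_nth v n"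
proof -
  have "(\<Sum>k\<le>n. fps_nth (fps_const c) k *\<^sub>C fps_nth v (n - k)) = (\<Sum>k\<in>{0}. fps_nth (fps_const c) k *\<^sub>C fps_nth v (n - k))"
    by (rule sum.mono_neutral_right) auto
  then show ?thesis by (simp add: fps_cauchy_nth)
qed

lemma fps_scaleC_X_power_nth:
  "fps_nth (fps_X ^ m \<cdot>\<^sub>\<lambda> v) n = (if n < m then 0 else fps_nth v (n - m))"
proof -
  have "(\<Sum>k\<le>n. fps_nth (fps_X ^ m) k *\<^sub>C fps_nth v (n - k)) =
      (\<Sum>k\<le>n. if k = m then fps_nth v (n - k) else (0::'a))"
    by (intro sum.cong) (auto simp: fps_X_power_nth)
  also have "\<dots> = (if n < m then 0 else fps_nth v (n - m))"
    by (subst sum.delta) auto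
  finally show ?thesis by (simp add: fps_cauchy_nth)
qed

lemma lambda_moduleD:
  assumes "lambda_module G"
  shows "0 \<in> G" "u \<in> G \<Longrightarrow> v \<in> G \<Longrightarrow> u + v \<in> G" "u \<in> G \<Longrightarrow> c \<cdot>\<^sub>\<lambda> u \<in> G"
    and "u \<in> G \<Longrightarrow> v \<in> G \<Longrightarrow> u - v \<in> G"
    and "(\<And>i. i \<in> I \<Longrightarrow> w i \<in> G) \<Longrightarrow> (\<Sum>i\<in>I. w i) \<in> G"
proof -
  show 0: "0 \<in> G" and add: "u \<in> G \<Longrightarrow> v \<in> G \<Longrightarrow> u + v \<in> G" and scale: "u \<in> G \<Longrightarrow> c \<cdot>\<^sub>\<lambda> u \<in> G" for u v c
    using assms by (simp_all add: lambda_module_def)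
  have "u + fps_const (-1) \<cdot>\<^sub>\<lambda> v = u - v"
    by (rule fps_ext) (simp add: fps_scaleC_const_nth)
  then show "u - v \<in> G" if "u \<in> G" "v \<in> G"
    using add[OF that(1) scale[OF that(2)]] by metis
  show "(\<Sum>i\<in>I. w i) \<in> G" if "\<And>i. i \<in> I \<Longrightarrow> w i \<in> G"
    using that by (induction I rule: infinite_finite_induct) (auto intro: 0 add)
qed

lemma agree_mod_module:
  assumes G: "lambda_module G"
  shows "lambda_module (agree_mod n G)"
  unfolding lambda_module_def
proof (intro conjI ballI allI)
  show "0 \<in> agree_mod n G"
    using lambda_moduleD(1)[OF G] unfolding agree_mod_def by blast
next
  fix u v assume "u \<in> agree_mod n G" "v \<in> agree_mod n G"
  then obtain g h where "g \<in> G" "h \<in> G" "\<forall>i<n. fps_nth u i = fps_nth g i" "\<forall>i<n. fps_nth v i = fps_nth h i"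
    unfolding agree_mod_def by blast
  then show "u + v \<in> agree_mod n G"
    unfolding agree_mod_def using lambda_moduleD(2)[OF G] by (auto intro!: bexI[of _ "g + h"])
next
  fix c u assume "u \<in> agree_mod n G"
  then obtain g where g: "g \<in> G" "\<forall>i<n. fps_nth u i = fps_nth g i"
    unfolding agree_mod_def by blast
  have "\<forall>i<n. fps_nth (c \<cdot>\<^sub>\<lambda> u) i = fps_nth (c \<cdot>\<^sub>\<lambda> g) i"
    using g(2) by (auto simp: fps_cauchy_nth intro!: sum.cong)
  then show "c \<cdot>\<^sub>\<lambda> u \<in> agree_mod n G"
    unfolding agree_mod_def using lambda_moduleD(3)[OF G g(1)] by blast
qed

text \<open>The enveloping algebra acts by a representation, so stabilisers are closed under
  products. Once the \<open>V b\<close> lie in one, so do all polynomials in them.\<close>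

lemma preserver_subalgebra:
  assumes G: "lambda_module G"
  shows "unital_subalgebra (preserver G)"
  unfolding unital_subalgebra_def complex_vector.subspace_def
proof (intro conjI ballI allI)
  have "fps_map_coeffs (uea_act 0) u = 0" for u :: "'a fps"
    by (rule fps_ext) (simp add: clinear_simps[OF clinear_uea_act(2)])
  then show "0 \<in> preserver G"
    by (simp add: preserver_def lambda_moduleD(1)[OF G])
  have "fps_map_coeffs (uea_act 1) u = u" for u :: "'a fps"
    by (rule fps_ext) (simp add: uea_act_one)
  then show "1 \<in> preserver G"
    by (simp add: preserver_def)
next
  fix x y assume xy: "x \<in> preserver G" "y \<in> preserver G"
  have "fps_map_coeffs (uea_act (x + y)) u = fps_map_coeffs (uea_act x) u + fps_map_coeffs (uea_act y) u" for u
    by (rule fps_ext) (simp add: uea_act_linear)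
  then show "x + y \<in> preserver G"
    using xy by (simp add: preserver_def lambda_moduleD(2)[OF G])
  have "fps_map_coeffs (uea_act (x * y)) u = fps_map_coeffs (uea_act x) (fps_map_coeffs (uea_act y) u)" for u
    by (rule fps_ext) (simp add: uea_act_mult)
  then show "x * y \<in> preserver G"
    using xy by (simp add: preserver_def)
next
  fix c x assume x: "x \<in> preserver G"
  have "fps_map_coeffs (uea_act (c *\<^sub>C x)) u = fps_const c \<cdot>\<^sub>\<lambda> fps_map_coeffs (uea_act x) u" for u
    by (rule fps_ext) (simp add: uea_act_linear fps_scaleC_const_nth)
  then show "c *\<^sub>C x \<in> preserver G"
    using x by (simp add: preserver_def lambda_moduleD(3)[OF G])
qed

lemma lambda_spanI: "v = (\<Sum>i<d. c i \<cdot>\<^sub>\<lambda> ts i) \<Longrightarrow> v \<in> lambda_span d ts"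
  unfolding lambda_span_def by blast

lemma lambda_span_module: "lambda_module (lambda_span d ts)"
  unfolding lambda_module_def
proof (intro conjI ballI allI)
  have "0 = (\<Sum>i<d. 0 \<cdot>\<^sub>\<lambda> ts i)"
    by (rule fps_ext) (simp add: fps_cauchy_nth fps_sum_nth)
  then show "0 \<in> lambda_span d ts" by (rule lambda_spanI)
next
  fix u v assume "u \<in> lambda_span d ts" "v \<in> lambda_span d ts"
  then obtain c c' where "u = (\<Sum>i<d. c i \<cdot>\<^sub>\<lambda> ts i)" "v = (\<Sum>i<d. c' i \<cdot>\<^sub>\<lambda> ts i)"
    unfolding lambda_span_def by blast
  then have "u + v = (\<Sum>i<d. (c i + c' i) \<cdot>\<^sub>\<lambda> ts i)"
    by (simp add: fps_scaleC_add sum.distrib)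
  then show "u + v \<in> lambda_span d ts"
    by (rule lambda_spanI)
next
  fix a u assume "u \<in> lambda_span d ts"
  then obtain c where "u = (\<Sum>i<d. c i \<cdot>\<^sub>\<lambda> ts i)"
    unfolding lambda_span_def by blast
  then have "a \<cdot>\<^sub>\<lambda> u = (\<Sum>i<d. (a * c i) \<cdot>\<^sub>\<lambda> ts i)"
    by (simp add: fps_scaleC_sum fps_scaleC_assoc)
  then show "a \<cdot>\<^sub>\<lambda> u \<in> lambda_span d ts"
    by (rule lambda_spanI)
qed

lemma lambda_span_base: "i < d \<Longrightarrow> ts i \<in> lambda_span d ts"
proof -
  assume i: "i < d"
  have "ts i = fps_const 1 \<cdot>\<^sub>\<lambda> ts i"
    by (rule fps_ext) (simp only: fps_scaleC_const_nth scaleC_one)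
  also have "\<dots> = (\<Sum>j<d. if j = i then fps_const 1 \<cdot>\<^sub>\<lambda> ts j else 0)"
    using i by simp
  also have "\<dots> = (\<Sum>j<d. fps_const (if j = i then 1 else 0) \<cdot>\<^sub>\<lambda> ts j)"
    by (intro sum.cong) (auto intro!: fps_ext simp: fps_cauchy_nth)
  finally show ?thesis
    by (rule lambda_spanI)
qed

lemma independent_coeffs_zero:
  fixes d :: nat
  assumes "inj_on t {..<d}" "complex_vector.independent (t ` {..<d})" "(\<Sum>i<d. c i *\<^sub>C t i) = 0" "i < d"
  shows "c i = 0"
proof -
  from assms obtain \<phi> where \<phi>: "clinear \<phi>" "\<And>j. j \<in> {..<d} \<Longrightarrow> \<phi> (t j) = (if j = i then 1 else (0::complex))"
    using dual_functional[of t "{..<d}" i] by blast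
  have "0 = \<phi> (\<Sum>i<d. c i *\<^sub>C t i)" using assms(3) by (simp add: clinear_simps[OF \<phi>(1)])
  also have "\<dots> = (\<Sum>j<d. c j *\<^sub>C \<phi> (t j))" by (simp add: clinear_simps[OF \<phi>(1)])
  also have "\<dots> = (\<Sum>j<d. if j = i then c j else 0)"
    by (intro sum.cong) (auto simp: \<phi>(2) scaleC_complex_def)
  also have "\<dots> = c i" using assms(4) by simp
  finally show ?thesis by simp
qed

section \<open>Saturation and closedness of the span of deformed generators\<close>

context
  fixes d :: nat and t :: "nat \<Rightarrow> 'l::complex_vector" and ts :: "nat \<Rightarrow> 'l fps"
  assumes gen: "deformed_generators d t ts"
    and t_inj: "inj_on t {..<d}" and t_ind: "complex_vector.independent (t ` {..<d})"
begin

text \<open>Induction on the order: once the lower coefficients of all \<open>c i\<close> vanish,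
  order \<open>j\<close> of the combination is a combination of the undeformed \<open>t i\<close>,
  which are independent.\<close>

lemma lambda_span_coeffs_zero:
  assumes zero: "\<And>j. j < n \<Longrightarrow> fps_nth (\<Sum>i<d. c i \<cdot>\<^sub>\<lambda> ts i) j = 0"
  shows "j < n \<Longrightarrow> i < d \<Longrightarrow> fps_nth (c i) j = 0"
proof (induction j arbitrary: i rule: less_induct)
  case (less j)
  have "(\<Sum>i<d. fps_nth (c i) j *\<^sub>C t i) = fps_nth (\<Sum>i<d. c i \<cdot>\<^sub>\<lambda> ts i) j"
    unfolding fps_sum_nth fps_cauchy_nth
  proof (intro sum.cong refl)
    fix i assume i: "i \<in> {..<d}"
    \<comment> \<open>Terms with \<open>k < j\<close> vanish by induction; in the one left,
      \<open>ts i\<close> contributes its order zero, \<open>t i\<close>.\<close>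
    have "(\<Sum>k\<le>j. fps_nth (c i) k *\<^sub>C fps_nth (ts i) (j - k)) =
        (\<Sum>k\<in>{j}. fps_nth (c i) k *\<^sub>C fps_nth (ts i) (j - k))"
      using less i by (intro sum.mono_neutral_right) auto
    then show "fps_nth (c i) j *\<^sub>C t i = (\<Sum>k\<le>j. fps_nth (c i) k *\<^sub>C fps_nth (ts i) (j - k))"
      using i gen by (simp add: deformed_generators_def)
  qed
  then show ?case
    using zero less.prems by (intro independent_coeffs_zero[OF t_inj t_ind, where c="\<lambda>i. fps_nth (c i) j"]) auto
qed

text \<open>Vanishing at order zero forces every coefficient series to vanish at order zero, so
  \<lambda> can be divided out of each of them.\<close>

lemma lambda_span_saturated:
  assumes h: "h \<in> lambda_span d ts" and h0: "fps_nth h 0 = 0"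
  shows "fps_shift 1 h \<in> lambda_span d ts"
proof -
  obtain c where c: "h = (\<Sum>i<d. c i \<cdot>\<^sub>\<lambda> ts i)" using h unfolding lambda_span_def by blast
  have c0: "fps_nth (c i) 0 = 0" if "i < d" for i
    using lambda_span_coeffs_zero[of 1 c 0 i] h0 that by (simp add: c)
  have "fps_shift 1 h = (\<Sum>i<d. fps_shift 1 (c i) \<cdot>\<^sub>\<lambda> ts i)"
    by (rule fps_ext) (simp add: c fps_sum_nth fps_cauchy_nth sum.atMost_Suc_shift c0 del: sum.atMost_Suc)
  then show ?thesis
    by (rule lambda_spanI)
qed

text \<open>The coefficients of an approximation modulo \<open>\<lambda>\<^sup>n\<close> are
  determined below order \<open>n\<close>. Different approximations therefore agree there and
  converge \<lambda>-adically to coefficients for \<open>v\<close>.\<close>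

lemma lambda_span_closed:
  assumes v: "\<And>n. v \<in> agree_mod n (lambda_span d ts)"
  shows "v \<in> lambda_span d ts"
proof -
  have "\<exists>c. \<forall>j<n. fps_nth v j = fps_nth (\<Sum>i<d. c i \<cdot>\<^sub>\<lambda> ts i) j" for n
    using v[of n] unfolding agree_mod_def lambda_span_def by blast
  then obtain c where c: "\<And>n j. j < n \<Longrightarrow> fps_nth v j = fps_nth (\<Sum>i<d. c n i \<cdot>\<^sub>\<lambda> ts i) j"
    by metis
  have coherent: "fps_nth (c n i) j = fps_nth (c (Suc j) i) j" if "j < n" "i < d" for n i j
  proof -
    have "fps_nth (\<Sum>i<d. (c n i - c (Suc j) i) \<cdot>\<^sub>\<lambda> ts i) k = 0" if "k < Suc j" for k
      using c[of k n] c[of k "Suc j"] that \<open>j < n\<close>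
      by (simp add: fps_sum_nth fps_cauchy_nth complex_vector.scale_left_diff_distrib sum_subtractf)
    from lambda_span_coeffs_zero[of "Suc j" "\<lambda>i. c n i - c (Suc j) i", OF this, of j i]
    show ?thesis using that by simp
  qed
  \<comment> \<open>Order \<open>j\<close> is read off the first approximation that determines it,
    number \<open>Suc j\<close>.\<close>
  define e where "e i = Abs_fps (\<lambda>j. fps_nth (c (Suc j) i) j)" for i
  have "v = (\<Sum>i<d. e i \<cdot>\<^sub>\<lambda> ts i)"
  proof (rule fps_ext)
    fix n
    have "fps_nth v n = (\<Sum>i<d. \<Sum>k\<le>n. fps_nth (c (Suc n) i) k *\<^sub>C fps_nth (ts i) (n - k))"
      using c[of n "Suc n"] by (simp add: fps_sum_nth fps_cauchy_nth)
    also have "\<dots> = fps_nth (\<Sum>i<d. e i \<cdot>\<^sub>\<lambda> ts i) n"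
      unfolding fps_sum_nth fps_cauchy_nth e_def
      by (intro sum.cong refl) (simp add: coherent[of _ "Suc n"])
    finally show "fps_nth v n = fps_nth (\<Sum>i<d. e i \<cdot>\<^sub>\<lambda> ts i) n" .
  qed
  then show ?thesis
    by (rule lambda_spanI)
qed

end

text \<open>Dividing \<open>z g\<close> by \<lambda> leaves \<open>c g + e y(g)\<close> plus terms
  that each carry a factor \<lambda>. Since \<open>z\<close> is controlled modulo
  \<open>\<lambda>\<^sup>n\<close>, these terms are controlled modulo
  \<open>\<lambda>\<^sup>n\<^sup>+\<^sup>1\<close>, and solving for \<open>y(g)\<close> gains one
  order.\<close>

lemma agree_mod_step:
  fixes G :: "'l::complex_lie_algebra fps set"
  assumes G: "lambda_module G"
    and sat: "\<And>h. h \<in> G \<Longrightarrow> fps_nth h 0 = 0 \<Longrightarrow> fps_shift 1 h \<in> G"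
    and z: "\<And>g. g \<in> G \<Longrightarrow> fps_cauchy uea_act z g \<in> G"
    and z0: "fps_nth z 0 = 0" and z1: "fps_nth z 1 = c *\<^sub>C 1 + e *\<^sub>C y" "e \<noteq> 0"
    and zP: "\<And>l. fps_nth z l \<in> preserver (agree_mod n G)"
  shows "y \<in> preserver (agree_mod (Suc n) G)"
  unfolding preserver_def
proof safe
  fix u assume "u \<in> agree_mod (Suc n) G"
  then obtain g where g: "g \<in> G" "\<And>i. i < Suc n \<Longrightarrow> fps_nth u i = fps_nth g i"
    unfolding agree_mod_def by blast
  have "g \<in> agree_mod n G" using g(1) unfolding agree_mod_def by blast
  then have "fps_map_coeffs (uea_act (fps_nth z l)) g \<in> agree_mod n G" for l
    using zP[of l] unfolding preserver_def by blast
  then have "\<forall>l. \<exists>w\<in>G. \<forall>i<n. uea_act (fps_nth z l) (fps_nth g i) = fps_nth w i"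
    unfolding agree_mod_def by simp
  then obtain w where w: "\<And>l. w l \<in> G" "\<And>l i. i < n \<Longrightarrow> uea_act (fps_nth z l) (fps_nth g i) = fps_nth (w l) i"
    by metis
  define h where "h = fps_cauchy uea_act z g"
  have hG: "fps_shift 1 h \<in> G"
    unfolding h_def by (intro sat z g(1)) (simp add: fps_cauchy_nth z0 clinear_simps[OF clinear_uea_act(2)])
  \<comment> \<open>The equation solved for \<open>y(g)\<close>, with the action of
    \<open>fps_nth z (l + 2)\<close> on \<open>g\<close> replaced by \<open>w (l + 2)\<close>, which
    lies in \<open>G\<close> and agrees with it below order \<open>n\<close>. Summands with
    \<open>l \<ge> n\<close> would start beyond order \<open>n\<close>.\<close>
  define g' where "g' = fps_const (inverse e) \<cdot>\<^sub>\<lambda>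
    (fps_shift 1 h - fps_const c \<cdot>\<^sub>\<lambda> g - (\<Sum>l<n. fps_X ^ Suc l \<cdot>\<^sub>\<lambda> w (Suc (Suc l))))"
  have "g' \<in> G"
    unfolding g'_def by (intro lambda_moduleD[OF G] hG g(1) w(1))
  moreover have "fps_nth (fps_map_coeffs (uea_act y) u) i = fps_nth g' i" if i: "i < Suc n" for i
  proof -
    have "fps_nth h (Suc i) = (\<Sum>l<Suc (Suc i). uea_act (fps_nth z l) (fps_nth g (Suc i - l)))"
      by (simp add: h_def fps_cauchy_nth lessThan_Suc_atMost)
    also have "\<dots> = c *\<^sub>C fps_nth g i + e *\<^sub>C uea_act y (fps_nth g i) +
        (\<Sum>l<i. uea_act (fps_nth z (Suc (Suc l))) (fps_nth g (i - Suc l)))"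
      using z1(1) by (simp add: sum.lessThan_Suc_shift z0 uea_act_linear uea_act_one
          clinear_simps[OF clinear_uea_act(2)] del: sum.lessThan_Suc)
    \<comment> \<open>The index \<open>i - Suc l\<close> is below \<open>n\<close> because
      \<open>i \<le> n\<close>: the extra factor \<lambda> is what makes \<open>w\<close> accurate
      enough.\<close>
    also have "(\<Sum>l<i. uea_act (fps_nth z (Suc (Suc l))) (fps_nth g (i - Suc l))) =
        (\<Sum>l<i. fps_nth (fps_X ^ Suc l \<cdot>\<^sub>\<lambda> w (Suc (Suc l))) i)"
      using i by (intro sum.cong refl) (simp add: fps_scaleC_X_power_nth w(2) del: power_Suc)
    also have "\<dots> = (\<Sum>l<n. fps_nth (fps_X ^ Suc l \<cdot>\<^sub>\<lambda> w (Suc (Suc l))) i)"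
      using i by (intro sum.mono_neutral_left) (auto simp: fps_scaleC_X_power_nth simp del: power_Suc)
    finally have "e *\<^sub>C uea_act y (fps_nth g i) =
        fps_nth (fps_shift 1 h - fps_const c \<cdot>\<^sub>\<lambda> g - (\<Sum>l<n. fps_X ^ Suc l \<cdot>\<^sub>\<lambda> w (Suc (Suc l)))) i"
      by (simp add: fps_scaleC_const_nth fps_sum_nth del: power_Suc)
    then have "inverse e *\<^sub>C e *\<^sub>C uea_act y (fps_nth g i) = fps_nth g' i"
      by (simp only: g'_def fps_scaleC_const_nth)
    then show ?thesis using z1(2) g(2)[OF i] by simp
  qed
  ultimately show "fps_map_coeffs (uea_act y) u \<in> agree_mod (Suc n) G"
    unfolding agree_mod_def by blast
qed

subsection \<open>The coideal condition\<close>

definition leg_contraction ::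
    "('a::complex_vector \<Rightarrow> complex) \<Rightarrow> ('b::complex_vector \<Rightarrow> 'v::complex_vector) \<Rightarrow> ('a, 'b) tensor fps \<Rightarrow> 'v fps"
  where "leg_contraction \<phi> \<psi> = fps_map_coeffs (tensor_lift (\<lambda>x y. \<phi> x *\<^sub>C \<psi> y))"

context
  fixes \<phi> :: "'a::complex_vector \<Rightarrow> complex" and \<psi> :: "'b::complex_vector \<Rightarrow> 'v::complex_vector"
  assumes \<phi>: "clinear \<phi>" and \<psi>: "clinear \<psi>"
begin

lemma leg_contraction_add:
  "leg_contraction \<phi> \<psi> (S + T) = leg_contraction \<phi> \<psi> S + leg_contraction \<phi> \<psi> T"
  by (rule fps_ext)
    (simp add: leg_contraction_def tensor_lift_add complex_bilinear_clinear \<phi> \<psi>)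

lemma leg_contraction_sum:
  "leg_contraction \<phi> \<psi> (\<Sum>i\<in>I. T i) = (\<Sum>i\<in>I. leg_contraction \<phi> \<psi> (T i))"
proof (induction I rule: infinite_finite_induct)
  have "leg_contraction \<phi> \<psi> 0 = 0"
    by (rule fps_ext)
      (simp add: leg_contraction_def tensor_lift_zero complex_bilinear_clinear \<phi> \<psi>)
  then show "infinite A \<Longrightarrow> leg_contraction \<phi> \<psi> (sum T A) = (\<Sum>i\<in>A. leg_contraction \<phi> \<psi> (T i))"
    and "leg_contraction \<phi> \<psi> (sum T {}) = (\<Sum>i\<in>{}. leg_contraction \<phi> \<psi> (T i))" for A
    by simp_all
qed (simp add: leg_contraction_add)

lemma leg_contraction_tensor:
  "leg_contraction \<phi> \<psi> (x \<otimes>\<^sub>\<lambda> y) = fps_map_coeffs \<phi> x \<cdot>\<^sub>\<lambda> fps_map_coeffs \<psi> y"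
  by (rule fps_ext)
    (simp add: leg_contraction_def fps_cauchy_nth tensor_lift_tensor
      clinear_simps[OF clinear_tensor_lift] complex_bilinear_clinear \<phi> \<psi>)

end

context
  fixes \<phi> :: "'l::complex_lie_algebra uea \<Rightarrow> complex" and \<psi> :: "'l uea \<Rightarrow> 'l"
  assumes \<phi>: "clinear \<phi>" and \<psi>: "clinear \<psi>"
    and \<psi>_one: "\<psi> 1 = 0" and \<psi>_uea_of: "\<And>u. \<psi> (uea_of u) = u"
begin

text \<open>Since \<open>\<psi>\<close> kills \<open>1\<close>, the summand with second leg
  \<open>1\<close> disappears, both from the coproduct and from its target space.\<close>

lemma leg_contraction_one: "leg_contraction \<phi> \<psi> (x \<otimes>\<^sub>\<lambda> 1) = 0"
proof -
  have "fps_map_coeffs \<psi> 1 = 0"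
    by (rule fps_ext) (simp add: \<psi>_one clinear_simps[OF \<psi>])
  then show ?thesis
    by (simp add: leg_contraction_tensor \<phi> \<psi>) (rule fps_ext, simp add: fps_cauchy_nth)
qed

lemma leg_contraction_uea_of:
  "leg_contraction \<phi> \<psi> (x \<otimes>\<^sub>\<lambda> fps_map_coeffs uea_of v) = fps_map_coeffs \<phi> x \<cdot>\<^sub>\<lambda> v"
proof -
  have "fps_map_coeffs \<psi> (fps_map_coeffs uea_of v) = v"
    by (rule fps_ext) (simp add: \<psi>_uea_of)
  then show ?thesis by (simp add: leg_contraction_tensor \<phi> \<psi>)
qed

text \<open>What survives is a combination of the \<open>v i\<close>, whose coefficients are the
  images of the \<open>\<xi> i\<close> under \<open>\<phi>\<close>.\<close>

lemma leg_contraction_coproduct_target: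
  assumes G: "lambda_module G" and T: "T \<in> coproduct_target G"
  shows "leg_contraction \<phi> \<psi> T \<in> G"
proof -
  obtain w m \<xi> v where "T = fps_map_coeffs uea_of w \<otimes>\<^sub>\<lambda> 1 + (\<Sum>i<m. \<xi> i \<otimes>\<^sub>\<lambda> fps_map_coeffs uea_of (v i))"
    and v: "\<forall>i<(m::nat). v i \<in> G"
    using T unfolding coproduct_target_def by blast
  then have "leg_contraction \<phi> \<psi> T = (\<Sum>i<m. fps_map_coeffs \<phi> (\<xi> i) \<cdot>\<^sub>\<lambda> v i)"
    by (simp add: leg_contraction_add leg_contraction_sum leg_contraction_one leg_contraction_uea_of \<phi> \<psi>)
  also have "\<dots> \<in> G"
    using v by (intro lambda_moduleD[OF G]) auto
  finally show ?thesis .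
qed

text \<open>The sum of \<open>\<phi>(X(r)) s\<close> over the legs \<open>r \<otimes> s\<close> of
  the inverse R-matrix: order \<open>k\<close> comes from the R-matrix, order \<open>l - k\<close>
  from X.\<close>

definition contracted_coproduct :: "'l twist \<Rightarrow> 'l uea fps"
  where "contracted_coproduct F = Abs_fps (\<lambda>l. \<Sum>k\<le>l.
    contract_first (\<lambda>x. \<phi> (fps_nth (twist_X F x) (l - k))) (fps_nth (ring_inverse (R_matrix F)) k))"

lemma clinear_functional_twist_X: "clinear (\<lambda>x. \<phi> (fps_nth (twist_X F x) m))"
  by (rule clinearI) (simp_all add: clinear_simps[OF clinear_twist_X] clinear_simps[OF \<phi>])

text \<open>\<open>\<psi>\<close> undoes the embedding of the second leg, so the contracted
  coproduct of \<open>u\<close> is the action on \<open>u\<close> of one power series over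
  \<open>U\<Xi>\<close> that is the same for all \<open>u\<close>.\<close>

lemma leg_contraction_star_coproduct:
  "leg_contraction \<phi> \<psi> (star_coproduct F u) = fps_cauchy uea_act (contracted_coproduct F) u"
proof (rule fps_ext)
  fix n
  define R where "R = fps_nth (ring_inverse (R_matrix F))"
  define X where "X x m = fps_nth (twist_X F x) m" for x m
  have X: "clinear (\<lambda>x. X x m)" "clinear (\<lambda>x. \<phi> (X x m))" for m
    unfolding X_def by (rule clinear_twist_X clinear_functional_twist_X)+
  have bil: "complex_bilinear (\<lambda>x y. \<phi> x *\<^sub>C \<psi> y)"
    by (intro complex_bilinear_clinear \<phi> \<psi>)
  have bilX: "complex_bilinear (\<lambda>x y. \<Sum>m\<le>j. X x m \<otimes> uea_of (uea_act y (fps_nth u (j - m))))" for j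
    by (rule complex_bilinearI)
      (simp_all add: clinear_simps[OF X(1)] uea_act_linear clinear_simps[OF clinear_uea_of]
        complex_bilinearD[OF tensor_bilinear] sum.distrib complex_vector.scale_sum_right)
  have pull: "uea_act (contract_first (\<lambda>x. \<phi> (X x m)) T) v =
      tensor_lift (\<lambda>x y. \<phi> (X x m) *\<^sub>C uea_act y v) T" for m T v
    unfolding contract_first_def
    by (subst clinear_compose_tensor_lift[OF clinear_uea_act(2) bilinear_contract_first[OF X(2)]])
      (simp add: uea_act_linear)
  have "fps_nth (leg_contraction \<phi> \<psi> (star_coproduct F u)) n =
      (\<Sum>k\<le>n. tensor_lift (\<lambda>x y. \<phi> x *\<^sub>C \<psi> y)
        (tensor_lift (\<lambda>x y. \<Sum>m\<le>n-k. X x m \<otimes> uea_of (uea_act y (fps_nth u (n - k - m)))) (R k)))"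
    unfolding star_coproduct_def leg_contraction_add[OF \<phi> \<psi>] leg_contraction_one
    by (simp add: leg_contraction_def fps_contract_def clinear_simps[OF clinear_tensor_lift[OF bil]]
        fps_cauchy_nth R_def X_def)
  also have "\<dots> = (\<Sum>k\<le>n. tensor_lift (\<lambda>x y. \<Sum>m\<le>n-k. \<phi> (X x m) *\<^sub>C uea_act y (fps_nth u (n - k - m))) (R k))"
    unfolding clinear_compose_tensor_lift[OF clinear_tensor_lift[OF bil] bilX]
      clinear_simps[OF clinear_tensor_lift[OF bil]] tensor_lift_tensor[OF bil] \<psi>_uea_of ..
  also have "\<dots> = (\<Sum>k=0..n. \<Sum>m=0..n-k. uea_act (contract_first (\<lambda>x. \<phi> (X x m)) (R k)) (fps_nth u (n - k - m)))"
    by (simp add: tensor_lift_sum_map pull atMost_atLeast0)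
  \<comment> \<open>Order \<open>k\<close> of the R-matrix and order \<open>m\<close> of X are
    regrouped by their sum \<open>l\<close>.\<close>
  also have "\<dots> = (\<Sum>l=0..n. \<Sum>k=0..l. uea_act (contract_first (\<lambda>x. \<phi> (X x (l - k))) (R k)) (fps_nth u (n - l)))"
    by (rule fps_mult_assoc_lemma[symmetric])
  also have "\<dots> = fps_nth (fps_cauchy uea_act (contracted_coproduct F) u) n"
    by (simp add: fps_cauchy_nth contracted_coproduct_def clinear_simps[OF clinear_uea_act(2)]
        R_def X_def atMost_atLeast0)
  finally show "fps_nth (leg_contraction \<phi> \<psi> (star_coproduct F u)) n =
    fps_nth (fps_cauchy uea_act (contracted_coproduct F) u) n" .
qed

end

section \<open>Isolating one vector field by a dual functional\<close>

lemma exp_lambda_nth_0: "fps_nth (exp_lambda T) 0 = (1::'a::complex_algebra_1)"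
  by (simp add: exp_lambda_def)

lemma exp_lambda_nth_1: "fps_nth (exp_lambda T) (Suc 0) = (T::'a::complex_algebra_1)"
  by (simp add: exp_lambda_def)

text \<open>The other index in the block of \<open>theta\<close> that contains
  \<open>b\<close>.\<close>

definition theta_partner :: "nat \<Rightarrow> nat"
  where "theta_partner b = (if even b then Suc b else b - 1)"

lemma theta_partner_less: "b < 2 * n \<Longrightarrow> theta_partner b < 2 * n"
  by (auto simp: theta_partner_def elim: evenE)

lemma theta_eq_0_iff: "theta a b = 0 \<longleftrightarrow> a \<noteq> theta_partner b"
  by (cases "even b"; cases "even a"; simp add: theta_def theta_partner_def; presburger)

text \<open>The functional picks the row of \<open>theta\<close> at the partner of \<open>b\<close>,
  whose only nonzero entry is in column \<open>b\<close>.\<close>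

lemma contract_first_theta_tensor:
  assumes \<phi>: "clinear \<phi>" and b: "b < 2*n"
    and dual: "\<And>a. a < 2*n \<Longrightarrow> \<phi> (uea_of (V a)) = (if a = theta_partner b then 1 else 0)"
  shows "contract_first \<phi> (theta_tensor n V) = theta (theta_partner b) b *\<^sub>C uea_of (V b)"
proof -
  have inj: "theta_partner b = theta_partner b' \<longleftrightarrow> b = b'" for b'
    by (cases "even b"; cases "even b'"; simp add: theta_partner_def; presburger)
  have "contract_first \<phi> (theta_tensor n V) =
      (\<Sum>a<2*n. \<Sum>b'<2*n. theta a b' *\<^sub>C \<phi> (uea_of (V a)) *\<^sub>C uea_of (V b'))"
    by (simp add: theta_tensor_def clinear_simps[OF clinear_contract_first[OF \<phi>]] contract_first_tensor[OF \<phi>])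
  also have "\<dots> = (\<Sum>a<2*n. if a = theta_partner b then \<Sum>b'<2*n. theta a b' *\<^sub>C uea_of (V b') else 0)"
    by (intro sum.cong) (auto simp: dual)
  also have "\<dots> = (\<Sum>b'<2*n. theta (theta_partner b) b' *\<^sub>C uea_of (V b'))"
    using theta_partner_less[OF b] by simp
  also have "\<dots> = (\<Sum>b'<2*n. if b' = b then theta (theta_partner b) b *\<^sub>C uea_of (V b) else 0)"
    by (intro sum.cong) (auto simp: theta_eq_0_iff inj)
  also have "\<dots> = theta (theta_partner b) b *\<^sub>C uea_of (V b)"
    using b by simp
  finally show ?thesis .
qed

text \<open>Successive approximation in \<lambda>: the order is raised by one for all
  \<open>V b\<close> simultaneously, because the higher coefficients of the contracted coproduct
  involve all of them. Closedness of \<open>G\<close> then passes to the limit.\<close>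

lemma RJS_twist_preserves_coideal:
  fixes V :: "nat \<Rightarrow> 'l::complex_lie_algebra" and G :: "'l fps set"
  assumes inj: "inj (uea_of :: 'l \<Rightarrow> 'l uea)"
    and V_zero_blocks: "\<forall>k<n. V (2*k) = 0 \<longleftrightarrow> V (2*k + 1) = 0"
    and V_distinct: "inj_on V {a. a < 2*n \<and> V a \<noteq> 0}"
    and V_independent: "complex_vector.independent (V ` {a. a < 2*n \<and> V a \<noteq> 0})"
    and G: "lambda_module G"
    and sat: "\<And>h. h \<in> G \<Longrightarrow> fps_nth h 0 = 0 \<Longrightarrow> fps_shift 1 h \<in> G"
    and closed: "\<And>v. (\<And>k. v \<in> agree_mod k G) \<Longrightarrow> v \<in> G"
    and coideal: "star_coideal (RJS_twist n V) G"
    and b: "b < 2*n"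
  shows "uea_of (V b) \<in> preserver G"
proof -
  define F where "F = RJS_twist n V"
  have F0: "fps_nth F 0 = 1" "fps_nth (ring_inverse F) 0 = 1"
    unfolding F_def ring_inverse_RJS_twist by (simp_all add: RJS_twist_eq exp_lambda_nth_0)
  have approx: "\<forall>b<2*n. uea_of (V b) \<in> preserver (agree_mod k G)" for k
  proof (induction k)
    case 0
    have "agree_mod 0 G = UNIV"
      using lambda_moduleD(1)[OF G] unfolding agree_mod_def by blast
    then show ?case by (simp add: preserver_def)
  next
    case (Suc k)
    show ?case
    proof (intro allI impI)
      fix b assume b: "b < 2*n"
      show "uea_of (V b) \<in> preserver (agree_mod (Suc k) G)"
      proof (cases "V b = 0")
        case True
        then show ?thesis
          using preserver_subalgebra[OF agree_mod_module[OF G], of "Suc k"]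
          by (simp add: clinear_simps[OF clinear_uea_of] unital_subalgebra_def complex_vector.subspace_0)
      next
        case False
        \<comment> \<open>The two fields of a block vanish together, so the partner of
          \<open>b\<close> belongs to the independent family and has a dual functional.\<close>
        have "V (theta_partner b) \<noteq> 0"
        proof (cases "even b")
          case True
          then obtain j where "b = 2*j" by (elim evenE)
          then show ?thesis using V_zero_blocks \<open>V b \<noteq> 0\<close> b by (auto simp: theta_partner_def)
        next
          case False
          then obtain j where "b = 2*j + 1" by (elim oddE)
          then show ?thesis using V_zero_blocks \<open>V b \<noteq> 0\<close> b by (auto simp: theta_partner_def)
        qed
        then have "theta_partner b \<in> {a. a < 2*n \<and> V a \<noteq> 0}"
          using theta_partner_less[OF b] by simp
        from V_distinct V_independent this obtain \<phi>\<^sub>0 where \<phi>\<^sub>0: "clinear \<phi>\<^sub>0"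
          "\<And>a. a \<in> {a. a < 2*n \<and> V a \<noteq> 0} \<Longrightarrow> \<phi>\<^sub>0 (V a) = (if a = theta_partner b then 1 else (0::complex))"
          by (rule dual_functional) (rule that)
        obtain \<psi> :: "'l uea \<Rightarrow> 'l" where \<psi>: "clinear \<psi>" "\<psi> 1 = 0" "\<And>u. \<psi> (uea_of u) = u"
          using inj by (rule uea_projection) (rule that)
        \<comment> \<open>Composing with \<open>\<psi>\<close> extends the functional to the
          enveloping algebra with \<open>\<phi> 1 = 0\<close>, which makes order zero of
          \<open>z\<close> vanish.\<close>
        define \<phi> where "\<phi> x = \<phi>\<^sub>0 (\<psi> x)" for x
        have \<phi>: "clinear \<phi>"
          by (rule clinearI) (simp_all add: \<phi>_def clinear_simps[OF \<phi>\<^sub>0(1)] clinear_simps[OF \<psi>(1)])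
        have \<phi>_one: "\<phi> 1 = 0" by (simp add: \<phi>_def \<psi>(2) clinear_simps[OF \<phi>\<^sub>0(1)])
        have dual: "\<phi> (uea_of (V a)) = (if a = theta_partner b then 1 else 0)" if "a < 2*n" for a
          using that \<phi>\<^sub>0(2)[of a] \<open>V (theta_partner b) \<noteq> 0\<close>
          by (cases "V a = 0") (auto simp: \<phi>_def \<psi>(3) clinear_simps[OF \<phi>\<^sub>0(1)])
        define R where "R = ring_inverse (R_matrix F)"
        have R: "R = exp_lambda (- \<i> *\<^sub>C theta_tensor n V)"
          unfolding R_def F_def by (rule inverse_R_matrix_RJS_twist)
        define z where "z = contracted_coproduct \<phi> F"
        have z_nth: "fps_nth z l =
            (\<Sum>k\<le>l. contract_first (\<lambda>x. \<phi> (fps_nth (twist_X F x) (l - k))) (fps_nth R k))" for l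
          by (simp add: z_def contracted_coproduct_def[OF \<phi> \<psi>] R_def)
        have lin: "clinear (\<lambda>x. \<phi> (fps_nth (twist_X F x) m))" for m
          by (rule clinear_functional_twist_X[OF \<phi> \<psi>])
        show ?thesis
        proof (rule agree_mod_step[OF G sat])
          show "fps_cauchy uea_act z g \<in> G" if "g \<in> G" for g
            using leg_contraction_coproduct_target[OF \<phi> \<psi> G, of "star_coproduct F g"] coideal that
            by (auto simp: leg_contraction_star_coproduct[OF \<phi> \<psi>] star_coideal_def F_def z_def)
          show "fps_nth z 0 = 0"
            using contract_first_tensor[OF lin[of 0], of 1 1]
            by (simp add: z_nth R exp_lambda_nth_0 one_tensor_def twist_X_0[OF F0] \<phi>_one)
          \<comment> \<open>Order one has two sources: order one of X against
            \<open>1 \<otimes> 1\<close> gives a scalar, and the linear term of the exponential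
            against order zero of X gives a multiple of \<open>V b\<close>.\<close>
          show "fps_nth z 1 = \<phi> (fps_nth (twist_X F 1) 1) *\<^sub>C 1 +
              (- \<i> * theta (theta_partner b) b) *\<^sub>C uea_of (V b)"
            using contract_first_tensor[OF lin[of 1], of 1 1] contract_first_theta_tensor[where V=V, OF \<phi> b dual]
            by (simp add: z_nth R exp_lambda_nth_0 exp_lambda_nth_1 one_tensor_def twist_X_0[OF F0]
                clinear_simps[OF clinear_contract_first[OF \<phi>]])
          show "- \<i> * theta (theta_partner b) b \<noteq> 0" by (simp add: theta_eq_0_iff)
          show "fps_nth z l \<in> preserver (agree_mod k G)" for l
          proof -
            have P: "unital_subalgebra (preserver (agree_mod k G))"
              by (intro preserver_subalgebra agree_mod_module G)
            \<comment> \<open>The second legs are polynomials in the \<open>V b\<close>, which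
              preserve \<open>G\<close> modulo \<open>\<lambda>\<^sup>k\<close> by the induction
              hypothesis.\<close>
            have "fps_nth R i \<in> second_legs_in (preserver (agree_mod k G))" for i
              unfolding R using Suc.IH by (intro exp_theta_tensor_second_legs[OF P]) auto
            then show ?thesis
              using P lin unfolding z_nth unital_subalgebra_def
              by (intro complex_vector.subspace_sum contract_first_in) auto
          qed
        qed
      qed
    qed
  qed
  show ?thesis
    unfolding preserver_def
  proof safe
    fix u assume "u \<in> G"
    then have "u \<in> agree_mod k G" for k unfolding agree_mod_def by blast
    then show "fps_map_coeffs (uea_act (uea_of (V b))) u \<in> G"
      using approx b by (intro closed) (auto simp: preserver_def)
  qed
qed

section \<open>The coideal property and invariance under the second legs\<close>

text \<open>At each order the first legs are independent, so a dual functional contracts the inverse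
  R-matrix to the single second leg \<open>q k j\<close>, which is therefore a polynomial in the
  \<open>V b\<close>.\<close>

lemma second_legs_preserveI:
  assumes P: "unital_subalgebra (preserver G)" and V: "\<And>b. b < 2*n \<Longrightarrow> uea_of (V b) \<in> preserver G"
    and dec: "leg_decomposition (ring_inverse (R_matrix (RJS_twist n V))) N p q"
  shows "second_legs_preserve N q G"
proof -
  have "q k j \<in> preserver G" if j: "j < N k" for k j
  proof -
    have inj: "inj_on (p k) {..<N k}" and ind: "complex_vector.independent (p k ` {..<N k})"
      and R: "fps_nth (ring_inverse (R_matrix (RJS_twist n V))) k = (\<Sum>j<N k. p k j \<otimes> q k j)"
      using dec unfolding leg_decomposition_def by blast+
    have "j \<in> {..<N k}" using j by simp
    with inj ind obtain \<phi>
      where \<phi>: "clinear \<phi>" "\<And>i. i \<in> {..<N k} \<Longrightarrow> \<phi> (p k i) = (if i = j then 1 else (0::complex))"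
      by (rule dual_functional) (rule that)
    have "contract_first \<phi> (\<Sum>i<N k. p k i \<otimes> q k i) = (\<Sum>i<N k. \<phi> (p k i) *\<^sub>C q k i)"
      by (simp add: clinear_simps[OF clinear_contract_first[OF \<phi>(1)]] contract_first_tensor[OF \<phi>(1)])
    also have "\<dots> = (\<Sum>i<N k. if i = j then q k i else 0)"
      by (intro sum.cong) (auto simp: \<phi>(2))
    also have "\<dots> = q k j" using j by simp
    finally have "q k j = contract_first \<phi> (fps_nth (ring_inverse (R_matrix (RJS_twist n V))) k)"
      by (simp add: R)
    also have "\<dots> \<in> preserver G"
      using P unfolding inverse_R_matrix_RJS_twist
      by (intro contract_first_in[OF _ \<phi>(1)] exp_theta_tensor_second_legs[OF P] V)
        (simp add: unital_subalgebra_def)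
    finally show ?thesis .
  qed
  then show ?thesis by (auto simp: second_legs_preserve_def preserver_def)
qed

lemma tensor_sum:
  "(\<Sum>i\<in>I. x i) \<otimes> y = (\<Sum>i\<in>I. x i \<otimes> y)" "y \<otimes> (\<Sum>i\<in>I. x' i) = (\<Sum>i\<in>I. y \<otimes> x' i)"
  by (induction I rule: infinite_finite_induct) (simp_all add: complex_bilinearD[OF tensor_bilinear])

text \<open>Power series scalars move from the second leg to the first. The product on the right
  keeps \<open>x\<close> as first factor, so that the triangular rearrangement applies.\<close>

lemma fps_tensor_scale_right:
  assumes h: "clinear h"
  shows "x \<otimes>\<^sub>\<lambda> fps_map_coeffs h (c \<cdot>\<^sub>\<lambda> v) = fps_cauchy (\<lambda>x c. c *\<^sub>C x) x c \<otimes>\<^sub>\<lambda> fps_map_coeffs h v"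
proof (rule fps_ext)
  fix n
  have "fps_nth (x \<otimes>\<^sub>\<lambda> fps_map_coeffs h (c \<cdot>\<^sub>\<lambda> v)) n =
      (\<Sum>k=0..n. \<Sum>l=0..n-k. (fps_nth c l *\<^sub>C fps_nth x k) \<otimes> h (fps_nth v (n - k - l)))"
    by (simp add: fps_cauchy_nth clinear_simps[OF h] complex_bilinearD[OF tensor_bilinear]
        tensor_sum atMost_atLeast0)
  also have "\<dots> = (\<Sum>k=0..n. \<Sum>l=0..k. (fps_nth c (k - l) *\<^sub>C fps_nth x l) \<otimes> h (fps_nth v (n - k)))"
    by (rule fps_mult_assoc_lemma[symmetric])
  also have "\<dots> = fps_nth (fps_cauchy (\<lambda>x c. c *\<^sub>C x) x c \<otimes>\<^sub>\<lambda> fps_map_coeffs h v) n"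
    by (simp add: fps_cauchy_nth complex_bilinearD[OF tensor_bilinear]
        tensor_sum atMost_atLeast0)
  finally show "fps_nth (x \<otimes>\<^sub>\<lambda> fps_map_coeffs h (c \<cdot>\<^sub>\<lambda> v)) n =
    fps_nth (fps_cauchy (\<lambda>x c. c *\<^sub>C x) x c \<otimes>\<^sub>\<lambda> fps_map_coeffs h v) n" .
qed

text \<open>
  The sum over all orders in \<open>\<lambda>\<close> becomes a finite one because \<open>\<gg>\<^sub>\<star>\<close> is finitely generated: the
  infinitely many first legs belonging to the same generator are added up \<open>\<lambda>\<close>-adically.
\<close>

lemma star_coidealI:
  fixes F :: "'l::complex_lie_algebra twist"
  assumes dec: "leg_decomposition (ring_inverse (R_matrix F)) N p q"
    and pres: "second_legs_preserve N q (lambda_span d ts)"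
  shows "star_coideal F (lambda_span d ts)"
  unfolding star_coideal_def
proof safe
  fix u assume u: "u \<in> lambda_span d ts"
  define R where "R = ring_inverse (R_matrix F)"
  define w where "w i = fps_map_coeffs uea_of (ts i)" for i
  define c where "c k j = (SOME c. fps_map_coeffs (uea_act (q k j)) u = (\<Sum>i<d. c i \<cdot>\<^sub>\<lambda> ts i))" for k j
  have c: "fps_map_coeffs (uea_act (q k j)) u = (\<Sum>i<d. c k j i \<cdot>\<^sub>\<lambda> ts i)" if j: "j < N k" for k j
  proof -
    have "fps_map_coeffs (uea_act (q k j)) u \<in> lambda_span d ts"
      using pres u j unfolding second_legs_preserve_def by blast
    then have "\<exists>c. fps_map_coeffs (uea_act (q k j)) u = (\<Sum>i<d. c i \<cdot>\<^sub>\<lambda> ts i)"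
      unfolding lambda_span_def by auto
    then show ?thesis unfolding c_def by (rule someI_ex)
  qed
  define \<eta> where "\<eta> k j i = fps_cauchy (\<lambda>x c. c *\<^sub>C x) (twist_X F (p k j)) (c k j i)" for k j i
  have leg: "twist_X F (p k j) \<otimes>\<^sub>\<lambda> fps_map_coeffs uea_of (fps_map_coeffs (uea_act (q k j)) u) =
      (\<Sum>i<d. \<eta> k j i \<otimes>\<^sub>\<lambda> w i)" if "j < N k" for k j
  proof -
    have "fps_map_coeffs uea_of (\<Sum>i<d. c k j i \<cdot>\<^sub>\<lambda> ts i) = (\<Sum>i<d. fps_map_coeffs uea_of (c k j i \<cdot>\<^sub>\<lambda> ts i))"
      by (rule fps_ext) (simp add: fps_sum_nth clinear_simps[OF clinear_uea_of])
    then show ?thesis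
      by (simp add: c[OF that] fps_cauchy_sum_right complex_bilinearD[OF tensor_bilinear]
          fps_tensor_scale_right[OF clinear_uea_of] \<eta>_def w_def)
  qed
  \<comment> \<open>Legs of order \<open>k\<close> in \<lambda> enter with shift \<open>k\<close>,
    so each coefficient is a finite sum.\<close>
  define \<xi> where "\<xi> i = Abs_fps (\<lambda>n. \<Sum>k\<le>n. \<Sum>j<N k. fps_nth (\<eta> k j i) (n - k))" for i
  have "fps_contract (\<lambda>x y. twist_X F x \<otimes>\<^sub>\<lambda> fps_map_coeffs uea_of (fps_map_coeffs (uea_act y) u)) R =
      (\<Sum>i<d. \<xi> i \<otimes>\<^sub>\<lambda> w i)" (is "fps_contract ?B R = _")
  proof (rule fps_ext)
    fix n
    have bil: "complex_bilinear (\<lambda>x y. fps_nth (?B x y) m)" for m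
      by (rule complex_bilinearI)
        (simp_all add: fps_cauchy_nth clinear_simps[OF clinear_twist_X] uea_act_linear
          clinear_simps[OF clinear_uea_of] complex_bilinearD[OF tensor_bilinear] sum.distrib
          complex_vector.scale_sum_right)
    \<comment> \<open>The sum over \<open>j\<close> moves innermost, so that the first legs
      belonging to one generator \<open>i\<close> add up.\<close>
    have sum_reorder: "(\<Sum>k\<in>K. \<Sum>j\<in>J k. \<Sum>i\<in>I. \<Sum>m\<in>M k. f k j i m) =
        (\<Sum>i\<in>I. \<Sum>k\<in>K. \<Sum>m\<in>M k. \<Sum>j\<in>J k. f k j i m)"
      for K :: "nat set" and J I M and f :: "nat \<Rightarrow> nat \<Rightarrow> nat \<Rightarrow> nat \<Rightarrow> ('l uea, 'l uea) tensor"
      unfolding sum.swap[of _ "J _" "I"] sum.swap[of _ K I] sum.swap[of _ "J _" "M _"] ..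
    have "fps_nth (fps_contract ?B R) n = (\<Sum>k\<le>n. \<Sum>j<N k. fps_nth (?B (p k j) (q k j)) (n - k))"
      using dec
      by (simp add: fps_contract_def R_def leg_decomposition_def clinear_simps[OF clinear_tensor_lift[OF bil]]
          tensor_lift_tensor[OF bil])
    also have "\<dots> = (\<Sum>k\<le>n. \<Sum>j<N k. \<Sum>i<d. fps_nth (\<eta> k j i \<otimes>\<^sub>\<lambda> w i) (n - k))"
      by (intro sum.cong refl) (simp add: leg fps_sum_nth)
    also have "\<dots> = (\<Sum>i<d. \<Sum>k=0..n. \<Sum>m=0..n-k. (\<Sum>j<N k. fps_nth (\<eta> k j i) m) \<otimes> fps_nth (w i) (n - k - m))"
      unfolding fps_cauchy_nth tensor_sum atMost_atLeast0 by (rule sum_reorder)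
    also have "\<dots> = (\<Sum>i<d. \<Sum>l=0..n. \<Sum>k=0..l. (\<Sum>j<N k. fps_nth (\<eta> k j i) (l - k)) \<otimes> fps_nth (w i) (n - l))"
      by (intro sum.cong refl fps_mult_assoc_lemma[symmetric])
    also have "\<dots> = fps_nth (\<Sum>i<d. \<xi> i \<otimes>\<^sub>\<lambda> w i) n"
      by (simp add: fps_sum_nth fps_cauchy_nth \<xi>_def atMost_atLeast0 tensor_sum)
    finally show "fps_nth (fps_contract ?B R) n = fps_nth (\<Sum>i<d. \<xi> i \<otimes>\<^sub>\<lambda> w i) n" .
  qed
  then have "star_coproduct F u = fps_map_coeffs uea_of u \<otimes>\<^sub>\<lambda> 1 + (\<Sum>i<d. \<xi> i \<otimes>\<^sub>\<lambda> fps_map_coeffs uea_of (ts i))"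
    by (simp add: star_coproduct_def R_def w_def)
  then show "star_coproduct F u \<in> coproduct_target (lambda_span d ts)"
    unfolding coproduct_target_def using u lambda_span_base[of _ d ts] by blast
qed

section \<open>The condition on the undeformed Lie algebra\<close>

lemma lie_span_closed:
  assumes S: "complex_vector.subspace S" and AB: "\<And>x y. x \<in> A \<Longrightarrow> y \<in> B \<Longrightarrow> lie x y \<in> S"
    and x: "x \<in> complex_vector.span A" and y: "y \<in> complex_vector.span B"
  shows "lie x y \<in> S"
proof -
  have "lie x y \<in> S" if "x \<in> A" for x
    using y
  proof (induction rule: complex_vector.span_induct_alt)
    case base
    show ?case using complex_vector.subspace_0[OF S] by simp
  next
    case (step c v w)
    then show ?case
      using AB[OF that step(1)]
      by (simp add: lie_add_right lie_scaleC_right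
          complex_vector.subspace_add[OF S] complex_vector.subspace_scale[OF S])
  qed
  from x show ?thesis
  proof (induction rule: complex_vector.span_induct_alt)
    case base
    show ?case using complex_vector.subspace_0[OF S] by simp
  next
    case (step c v w)
    then show ?case
      using \<open>\<And>x. x \<in> A \<Longrightarrow> lie x y \<in> S\<close>
      by (simp add: lie_add_left lie_scaleC_left
          complex_vector.subspace_add[OF S] complex_vector.subspace_scale[OF S])
  qed
qed

text \<open>Invariance of the deformed span under every \<open>V b\<close> yields both the
  equivalence and, at order zero in \<lambda>, the condition on the undeformed span. Lower rank of
  the matrix is represented by blocks of zero fields.\<close>

theorem proposition1:
  fixes n d :: nat
    and V t :: "nat \<Rightarrow> 'm::smooth_manifold vector_field"
    and f :: "nat \<Rightarrow> nat \<Rightarrow> nat \<Rightarrow> complex"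
  assumes V_commute: "\<forall>a<2*n. \<forall>b<2*n. lie (V a) (V b) = 0"
    and V_zero_blocks: "\<forall>k<n. V (2*k) = 0 \<longleftrightarrow> V (2*k + 1) = 0"
    and V_distinct: "inj_on V {a. a < 2*n \<and> V a \<noteq> 0}"
    and V_independent: "complex_vector.independent (V ` {a. a < 2*n \<and> V a \<noteq> 0})"
    and t_distinct: "inj_on t {..<d}"
    and t_independent: "complex_vector.independent (t ` {..<d})"
    and t_structure: "\<forall>i<d. \<forall>j<d. lie (t i) (t j) = (\<Sum>k<d. f i j k *\<^sub>C t k)"
  shows
    "(\<forall>ts N p q.
        deformed_generators d t ts \<longrightarrow>
        leg_decomposition (ring_inverse (R_matrix (RJS_twist n V))) N p q \<longrightarrow>
        (star_coideal (RJS_twist n V) (lambda_span d ts) \<longleftrightarrow>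
         second_legs_preserve N q (lambda_span d ts))) \<and>
     ((\<exists>ts. deformed_generators d t ts \<and>
            star_closed (RJS_twist n V) d f ts \<and>
            star_coideal (RJS_twist n V) (lambda_span d ts)) \<longrightarrow>
        (\<forall>a<2*n. \<forall>x\<in>complex_vector.span (t ` {..<d}).
           lie (V a) x \<in> complex_vector.span (t ` {..<d})) \<and>
        lie_subalgebra (complex_vector.span (t ` {..<d} \<union> V ` {..<2*n})) \<and>
        lie_ideal (complex_vector.span (t ` {..<d}))
          (complex_vector.span (t ` {..<d} \<union> V ` {..<2*n})))"
proof (intro conjI allI impI ballI)
  have preserved: "uea_of (V b) \<in> preserver (lambda_span d ts)"
    if gen: "deformed_generators d t ts" and coideal: "star_coideal (RJS_twist n V) (lambda_span d ts)"
      and "b < 2*n" for ts b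
    using inj_uea_of_vector_field V_zero_blocks V_distinct V_independent lambda_span_module
      lambda_span_saturated[OF gen t_distinct t_independent]
      lambda_span_closed[OF gen t_distinct t_independent] coideal that(3)
    by (rule RJS_twist_preserves_coideal)
  show "star_coideal (RJS_twist n V) (lambda_span d ts) \<longleftrightarrow> second_legs_preserve N q (lambda_span d ts)"
    if "deformed_generators d t ts" "leg_decomposition (ring_inverse (R_matrix (RJS_twist n V))) N p q"
    for ts N p q
    using that preserved[of ts] star_coidealI[OF that(2)]
      second_legs_preserveI[OF preserver_subalgebra[OF lambda_span_module] _ that(2)] by blast
  assume "\<exists>ts. deformed_generators d t ts \<and> star_closed (RJS_twist n V) d f ts \<and>
    star_coideal (RJS_twist n V) (lambda_span d ts)"
  then obtain ts where ts: "deformed_generators d t ts" "star_coideal (RJS_twist n V) (lambda_span d ts)"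
    by blast
  define g where "g = complex_vector.span (t ` {..<d})"
  define h where "h = complex_vector.span (t ` {..<d} \<union> V ` {..<2*n})"
  have g: "complex_vector.subspace g" and h: "complex_vector.subspace h" and gh: "g \<subseteq> h"
    unfolding g_def h_def by (auto intro: complex_vector.span_mono[THEN subsetD])
  have comb: "(\<Sum>k<d. c k *\<^sub>C t k) \<in> g" for c
    unfolding g_def
    by (intro complex_vector.span_sum complex_vector.span_scale complex_vector.span_base imageI)
  have Vt: "lie (V a) (t i) \<in> g" if a: "a < 2*n" and i: "i < d" for a i
  proof -
    have "fps_map_coeffs (uea_act (uea_of (V a))) (ts i) \<in> lambda_span d ts"
      using preserved[OF ts a] lambda_span_base[OF i] unfolding preserver_def by blast
    then obtain c where c: "fps_map_coeffs (uea_act (uea_of (V a))) (ts i) = (\<Sum>k<d. c k \<cdot>\<^sub>\<lambda> ts k)"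
      unfolding lambda_span_def by blast
    \<comment> \<open>Order zero of the relation \<open>c\<close>: each \<open>ts k\<close> starts
      with \<open>t k\<close>.\<close>
    have "lie (V a) (t i) = (\<Sum>k<d. fps_nth (c k) 0 *\<^sub>C t k)"
      using arg_cong[OF c, of "\<lambda>v. fps_nth v 0"] ts(1) i
      by (simp add: uea_act_uea_of fps_sum_nth fps_cauchy_nth deformed_generators_def)
    then show ?thesis using comb by simp
  qed
  have tt: "lie (t i) (t j) \<in> g" if "i < d" "j < d" for i j
    using t_structure that comb by simp
  have ideal: "lie x y \<in> g" if "x \<in> h" "y \<in> g" for x y
    using that unfolding h_def g_def
    by (rule lie_span_closed[rotated 2]) (use g Vt tt in \<open>auto simp: g_def\<close>)
  have tV: "lie (t i) (V a) \<in> g" if "a < 2*n" "i < d" for a i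
    using complex_vector.subspace_neg[OF g Vt[OF that]] lie_anticommute[of "t i" "V a"] by simp
  \<comment> \<open>On generators, brackets involving some \<open>t i\<close> lie in
    \<open>g\<close>, and brackets of two \<open>V a\<close> vanish.\<close>
  have sub: "lie x y \<in> h" if "x \<in> h" "y \<in> h" for x y
    using that unfolding h_def
    by (rule lie_span_closed[rotated 2])
      (use h gh Vt tt tV V_commute complex_vector.subspace_0[OF h] in \<open>auto simp: h_def\<close>)
  show "lie (V a) x \<in> complex_vector.span (t ` {..<d})"
    if "a < 2*n" "x \<in> complex_vector.span (t ` {..<d})" for a x
  proof -
    have "V a \<in> h" unfolding h_def using that(1) by (intro complex_vector.span_base) auto
    then show ?thesis using ideal that(2) unfolding g_def by blast
  qed
  show "lie_subalgebra (complex_vector.span (t ` {..<d} \<union> V ` {..<2*n}))"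
    using h sub unfolding h_def lie_subalgebra_def by blast
  show "lie_ideal (complex_vector.span (t ` {..<d})) (complex_vector.span (t ` {..<d} \<union> V ` {..<2*n}))"
    using g gh ideal unfolding g_def h_def lie_ideal_def by blast
qed

end
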